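(* (Discrete Korn inequality.) Suppose that $\mathcal R\subset\mathcal G$ has Property 2. Then the seminorms $\|\cdot\|_{\mathcal R}$ and $\|\cdot\|_{\mathcal R,0}$ on $U_{\mathrm{per}}$ are equivalent.
   Context: Euclidean group: $\mathrm E(n)$ consists of pairs $(A|b)$, $A\in\mathrm O(n)$, $b\in\mathbb R^n$, acting by $(A|b)\cdot x=Ax+b$, product $(A_1|b_1)(A_2|b_2)=(A_1A_2|b_1+A_1b_2)$; $\mathrm{rot}(A|b)=A$. Standing setting: $d=d_1+d_2$; $\mathcal S<\mathrm E(d_2)$ is a space group (discrete, containing $d_2$ translations with linearly independent translation vectors) with translation subgroup $\mathcal T_{\mathcal S}$; $A\oplus(B|b)=(\mathrm{diag}(A,B)|(0,b))$. $\mathcal G$ is a discrete subgroup of $\mathrm E(d)$ contained in $\{A\oplus s:A\in\mathrm O(d_1),s\in\mathcal S\}$ projecting ($A\oplus s\mapsto s$) onto $\mathcal S$; $\mathcal T\subset\mathcal G$ maps bijectively onto $\mathcal T_{\mathcal S}$. There is $m_0\in\mathbb N$ such that $\mathcal T^N=\{t^N:t\in\mathcal T\}$ is a normal subgroup of $\mathcal G$ iff $N\in\mathcal M=m_0\mathbb N$, and then it is isomorphic to $\mathbb Z^{d_2}$ and of finite index; $\mathcal C_N$ is a fixed set of representatives of $\mathcal G/\mathcal T^N$. $U_{\mathrm{per}}$: maps $u:\mathcal G\to\mathbb R^d$ that are $\mathcal T^N$-periodic ($u(gt)=u(g)$ for $g\in\mathcal G,t\in\mathcal T^N$) for some $N\in\mathcal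 M$. $x_0\in\mathbb R^d$ with $g\mapsto g\cdot x_0$ injective; $d_{\mathrm{aff}}=\dim\mathrm{aff}(\mathcal G\cdot x_0)$; assumed $\mathcal G\cdot x_0\subset\{0_{d-d_{\mathrm{aff}}}\}\times\mathbb R^{d_{\mathrm{aff}}}$ and $\mathcal G$ acts trivially on $\mathbb R^{d-d_{\mathrm{aff}}}\times\{0_{d_{\mathrm{aff}}}\}$. For $\mathcal R\subset\mathcal G$: $U_{\mathrm{iso}}(\mathcal R)$ (resp. $U_{\mathrm{iso},0}(\mathcal R)$) is the set of $v:\mathcal R\to\mathbb R^d$ for which there are $a\in\mathbb R^d$ and $S\in\mathrm{Skew}(d)$ (resp. $S\in\mathrm{Skew}_{0,d_2}(d):=\{\begin{pmatrix}S_1&S_2\\-S_2^T&0\end{pmatrix}:S_1\in\mathrm{Skew}(d_1),S_2\in\mathbb R^{d_1\times d_2}\}$) with $\mathrm{rot}(g)v(g)=a+S(g\cdot x_0-x_0)$ for all $g\in\mathcal R$. For finite $\mathcal R$ and $\mathcal T^N$-periodic $u$: $\|u\|_{\mathcal R}=\big(\frac1{|\mathcal C_N|}\sum_{g\in\mathcal C_N}\mathrm{dist}(u(g\,\cdot)|_{\mathcal R},U_{\mathrm{iso}}(\mathcal R))^2\big)^{1/2}$ and $\|u\|_{\mathcal R,0}$ is defined likewise with $U_{\mathrm{iso},0}(\mathcal R)$; distances in the Euclidean norm on $(\mathbb R^d)^{\mathcal R}$. Property 1: $\mathcal R$ finite, $\mathrm{id}\in\mathcal R$, $\mathrm{aff}(\mathcal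 R\cdot x_0)=\mathrm{aff}(\mathcal G\cdot x_0)$. Property 2: $\mathcal R$ finite and there are $\mathcal R',\mathcal R''\subset\mathcal G$ with $\mathrm{id}\in\mathcal R'$, $\mathcal R'$ generating $\mathcal G$, $\mathcal R''$ having Property 1, and $\{gh:g\in\mathcal R',h\in\mathcal R''\}\subset\mathcal R$. *)

theory Defs
  imports Complex_Main
begin

text \<open>Explicit-dimension linear algebra.  A vector of R^n is a function
  nat => real vanishing at indices >= n (coordinates 0..n-1); an n x n matrix
  is a function nat => nat => real vanishing outside {0..<n} x {0..<n}.
  Coordinates 0..d1-1 are the R^d1 block, coordinates d1..d1+d2-1 the R^d2 block.\<close>

type_synonym vec = "nat \<Rightarrow> real"
type_synonym mat = "nat \<Rightarrow> nat \<Rightarrow> real"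
type_synonym euc = "mat \<times> vec"

definition vecs :: "nat \<Rightarrow> vec set" where
  "vecs n = {x. \<forall>i\<ge>n. x i = 0}"

definition mats :: "nat \<Rightarrow> mat set" where
  "mats n = {A. \<forall>i j. (n \<le> i \<or> n \<le> j) \<longrightarrow> A i j = 0}"

definition idm :: "nat \<Rightarrow> mat" where
  "idm n = (\<lambda>i j. if i = j \<and> i < n then 1 else 0)"

definition mtrans :: "mat \<Rightarrow> mat" where
  "mtrans A = (\<lambda>i j. A j i)"

definition mmult :: "nat \<Rightarrow> mat \<Rightarrow> mat \<Rightarrow> mat" where
  "mmult n A B = (\<lambda>i j. \<Sum>k<n. A i k * B k j)"

definition mvmult :: "nat \<Rightarrow> mat \<Rightarrow> vec \<Rightarrow> vec" where
  "mvmult n A x = (\<lambda>i. \<Sum>j<n. A i j * x j)"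

definition orth :: "nat \<Rightarrow> mat \<Rightarrow> bool" where
  "orth n A \<longleftrightarrow> A \<in> mats n \<and> mmult n (mtrans A) A = idm n"

definition skew :: "nat \<Rightarrow> mat \<Rightarrow> bool" where
  "skew n S \<longleftrightarrow> S \<in> mats n \<and> (\<forall>i j. S j i = - S i j)"

definition skew0 :: "nat \<Rightarrow> nat \<Rightarrow> mat \<Rightarrow> bool" where
  "skew0 d1 d2 S \<longleftrightarrow> skew (d1 + d2) S \<and> (\<forall>i j. d1 \<le> i \<longrightarrow> d1 \<le> j \<longrightarrow> S i j = 0)"

definition Eucl :: "nat \<Rightarrow> euc set" where
  "Eucl n = {(A, b). orth n A \<and> b \<in> vecs n}"

definition emult :: "nat \<Rightarrow> euc \<Rightarrow> euc \<Rightarrow> euc" where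
  "emult n g h = (mmult n (fst g) (fst h), (\<lambda>i. snd g i + mvmult n (fst g) (snd h) i))"

definition eid :: "nat \<Rightarrow> euc" where
  "eid n = (idm n, (\<lambda>_. 0))"

definition einv :: "nat \<Rightarrow> euc \<Rightarrow> euc" where
  "einv n g = (mtrans (fst g), (\<lambda>i. - mvmult n (mtrans (fst g)) (snd g) i))"

definition act :: "nat \<Rightarrow> euc \<Rightarrow> vec \<Rightarrow> vec" where
  "act n g x = (\<lambda>i. mvmult n (fst g) x i + snd g i)"

definition rot :: "euc \<Rightarrow> mat" where
  "rot g = fst g"

definition epow :: "nat \<Rightarrow> euc \<Rightarrow> nat \<Rightarrow> euc" where
  "epow n g k = ((emult n g) ^^ k) (eid n)"

definition esubgroup :: "nat \<Rightarrow> euc set \<Rightarrow> bool" where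
  "esubgroup n H \<longleftrightarrow> H \<subseteq> Eucl n \<and> eid n \<in> H \<and>
     (\<forall>g\<in>H. \<forall>h\<in>H. emult n g h \<in> H) \<and> (\<forall>g\<in>H. einv n g \<in> H)"

definition enormal :: "nat \<Rightarrow> euc set \<Rightarrow> euc set \<Rightarrow> bool" where
  "enormal n H G \<longleftrightarrow> esubgroup n H \<and> H \<subseteq> G \<and>
     (\<forall>g\<in>G. \<forall>h\<in>H. emult n (emult n g h) (einv n g) \<in> H)"

definition egen :: "nat \<Rightarrow> euc set \<Rightarrow> euc set" where
  "egen n X = \<Inter>{H. esubgroup n H \<and> X \<subseteq> H}"

definition lcosets :: "nat \<Rightarrow> euc set \<Rightarrow> euc set \<Rightarrow> euc set set" where
  "lcosets n G H = {(\<lambda>h. emult n g h) ` H | g. g \<in> G}"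

definition reps :: "nat \<Rightarrow> euc set \<Rightarrow> euc set \<Rightarrow> euc set \<Rightarrow> bool" where
  "reps n G H C \<longleftrightarrow> C \<subseteq> G \<and> (\<forall>g\<in>G. \<exists>!c. c \<in> C \<and> (\<exists>h\<in>H. g = emult n c h))"

definition edist :: "nat \<Rightarrow> euc \<Rightarrow> euc \<Rightarrow> real" where
  "edist n g h = sqrt ((\<Sum>i<n. \<Sum>j<n. (fst g i j - fst h i j)\<^sup>2) + (\<Sum>i<n. (snd g i - snd h i)\<^sup>2))"

definition ediscrete :: "nat \<Rightarrow> euc set \<Rightarrow> bool" where
  "ediscrete n H \<longleftrightarrow> (\<forall>g\<in>H. \<exists>e>0. \<forall>h\<in>H. edist n g h < e \<longrightarrow> h = g)"

definition lin_indep :: "nat \<Rightarrow> (nat \<Rightarrow> vec) \<Rightarrow> nat \<Rightarrow> bool" where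
  "lin_indep n vs k \<longleftrightarrow>
     (\<forall>c. (\<forall>i<n. (\<Sum>j<k. c j * vs j i) = 0) \<longrightarrow> (\<forall>j<k. c j = 0))"

definition transl :: "nat \<Rightarrow> euc set \<Rightarrow> euc set" where
  "transl n S = {s \<in> S. fst s = idm n}"

definition space_group :: "nat \<Rightarrow> euc set \<Rightarrow> bool" where
  "space_group n S \<longleftrightarrow> esubgroup n S \<and> ediscrete n S \<and>
     (\<exists>vs. (\<forall>k<n. (idm n, vs k) \<in> S) \<and> lin_indep n vs n)"

definition oplus :: "nat \<Rightarrow> nat \<Rightarrow> mat \<Rightarrow> euc \<Rightarrow> euc" where
  "oplus d1 d2 A s =
     ((\<lambda>i j. if i < d1 \<and> j < d1 then A i j
             else if d1 \<le> i \<and> i < d1 + d2 \<and> d1 \<le> j \<and> j < d1 + d2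
                  then fst s (i - d1) (j - d1) else 0),
      (\<lambda>i. if d1 \<le> i \<and> i < d1 + d2 then snd s (i - d1) else 0))"

definition proj2 :: "nat \<Rightarrow> nat \<Rightarrow> euc \<Rightarrow> euc" where
  "proj2 d1 d2 g =
     ((\<lambda>i j. if i < d2 \<and> j < d2 then fst g (i + d1) (j + d1) else 0),
      (\<lambda>i. if i < d2 then snd g (i + d1) else 0))"

definition Tpow :: "nat \<Rightarrow> euc set \<Rightarrow> nat \<Rightarrow> euc set" where
  "Tpow n T N = {epow n t N | t. t \<in> T}"

definition affhull :: "nat \<Rightarrow> vec set \<Rightarrow> vec set" where
  "affhull n X = {y. \<exists>(k::nat) xs c. (\<forall>j<k. xs j \<in> X) \<and> (\<Sum>j<k. c j) = (1::real) \<and>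
                        y = (\<lambda>i. \<Sum>j<k. c j * xs j i)}"

definition affdim :: "nat \<Rightarrow> vec set \<Rightarrow> nat" where
  "affdim n X = Max {k. \<exists>vs. (\<forall>j<k. vs j \<in> {(\<lambda>i. x i - y i) | x y. x \<in> X \<and> y \<in> X})
                              \<and> lin_indep n vs k}"

text \<open>U_iso(R), U_iso,0(R): maps R -> R^d (values outside R are irrelevant).\<close>
definition Uiso_gen :: "nat \<Rightarrow> (mat \<Rightarrow> bool) \<Rightarrow> vec \<Rightarrow> euc set \<Rightarrow> (euc \<Rightarrow> vec) set" where
  "Uiso_gen d P x0 R = {v. (\<forall>g\<in>R. v g \<in> vecs d) \<and>
      (\<exists>a\<in>vecs d. \<exists>S. P S \<and>
         (\<forall>g\<in>R. mvmult d (rot g) (v g) = (\<lambda>i. a i + mvmult d S (\<lambda>k. act d g x0 k - x0 k) i)))}"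

definition Uiso :: "nat \<Rightarrow> vec \<Rightarrow> euc set \<Rightarrow> (euc \<Rightarrow> vec) set" where
  "Uiso d x0 R = Uiso_gen d (skew d) x0 R"

definition Uiso0 :: "nat \<Rightarrow> nat \<Rightarrow> vec \<Rightarrow> euc set \<Rightarrow> (euc \<Rightarrow> vec) set" where
  "Uiso0 d1 d2 x0 R = Uiso_gen (d1 + d2) (skew0 d1 d2) x0 R"

definition distR :: "nat \<Rightarrow> euc set \<Rightarrow> (euc \<Rightarrow> vec) \<Rightarrow> (euc \<Rightarrow> vec) set \<Rightarrow> real" where
  "distR d R w V = Inf {sqrt (\<Sum>h\<in>R. \<Sum>i<d. (w h i - v h i)\<^sup>2) | v. v \<in> V}"

definition seminorm :: "nat \<Rightarrow> euc set \<Rightarrow> (euc \<Rightarrow> vec) set \<Rightarrow> euc set \<Rightarrow> (euc \<Rightarrow> vec) \<Rightarrow> real" where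
  "seminorm d R V C u =
     sqrt ((1 / real (card C)) * (\<Sum>g\<in>C. (distR d R (\<lambda>h. u (emult d g h)) V)\<^sup>2))"

definition periodic :: "nat \<Rightarrow> euc set \<Rightarrow> euc set \<Rightarrow> (euc \<Rightarrow> vec) \<Rightarrow> bool" where
  "periodic d G H u \<longleftrightarrow> (\<forall>g\<in>G. \<forall>t\<in>H. u (emult d g t) = u g)"

definition prop1 :: "nat \<Rightarrow> euc set \<Rightarrow> vec \<Rightarrow> euc set \<Rightarrow> bool" where
  "prop1 d G x0 R \<longleftrightarrow> R \<subseteq> G \<and> finite R \<and> eid d \<in> R \<and>
     affhull d ((\<lambda>g. act d g x0) ` R) = affhull d ((\<lambda>g. act d g x0) ` G)"

definition prop2 :: "nat \<Rightarrow> euc set \<Rightarrow> vec \<Rightarrow> euc set \<Rightarrow> bool" where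
  "prop2 d G x0 R \<longleftrightarrow> R \<subseteq> G \<and> finite R \<and>
     (\<exists>R' R''. R' \<subseteq> G \<and> eid d \<in> R' \<and> egen d R' = G \<and> prop1 d G x0 R'' \<and>
        {emult d g h | g h. g \<in> R' \<and> h \<in> R''} \<subseteq> R)"

end

(* Put S g for an (almost) optimal skew matrix at g and e g for its error. Where the patches of two
   group elements overlap, their infinitesimal rigid motions nearly agree; hence along the generating
   set, and then along every fixed p in G, the matrix S is nearly conjugated by rot p and u is nearly
   affine, with errors bounded in l2 by e. Subtracting from the last d2 components of u the part due
   to the rotation of the bounded first d1 coordinates leaves a function f on the finite group G/T^N
   whose difference in the direction of a lattice vector tau is S3 tau up to such an error, where S3
   is the lower right block of S. With phi_i = tau_i . f and D_j the difference operator of the j-th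
   lattice generator, the D_j phi_i are skew in (i, j) up to errors. As the generators commute,
   discrete integration by parts turns the sum of D_j phi_i D_i phi_j into a sum of shifts of
   D_i phi_i D_j phi_j, which consists of errors only; so the skew part is itself bounded by the
   errors. This is the proof of Korn's inequality on the torus, and it shows that S3 can be dropped. *)
theory Submission
  imports Defs "HOL-Analysis.Convex"
begin

section \<open>The Euclidean group and sums over coset representatives\<close>

text \<open>The constant must not depend on the period N, so compactness on a single quotient is of
  no use: every estimate is claimed for all normal subgroups H with a finite set of representatives
  at once. A patch around g sees \<open>S g\<close> only through its values on displacements of the
  orbit, whose span is {0} x R^daff. The conjugation law for S is therefore claimed on that space
  alone; it contains the last d2 unit vectors because the lattice translations force daff \<ge> d2.
  The constant belonging to a group element p depends on p, which does no harm since only d2 fixed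
  elements are used later. These are m0-th powers of lifts of a lattice basis: T is just a set of
  lifts, which need not commute, whereas T^m0 is a group whose elements are determined by their
  projections. Optimal rigid motions are not shown to exist; approximants with a slack delta are
  used instead, and the slack is removed at the end.\<close>

lemma mvmult_add: "mvmult n A (\<lambda>i. x i + y i) = (\<lambda>i. mvmult n A x i + mvmult n A y i)"
  by (simp add: mvmult_def algebra_simps sum.distrib)

lemma mvmult_diff: "mvmult n A (\<lambda>i. x i - y i) = (\<lambda>i. mvmult n A x i - mvmult n A y i)"
  by (simp add: mvmult_def algebra_simps sum_subtractf)

lemma mvmult_scale: "mvmult n A (\<lambda>i. c * x i) = (\<lambda>i. c * mvmult n A x i)"
  by (simp add: mvmult_def sum_distrib_left algebra_simps)

lemma mvmult_minus: "mvmult n A (\<lambda>i. - x i) = (\<lambda>i. - mvmult n A x i)"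
  by (simp add: mvmult_def sum_negf)

lemma mvmult_sum: "mvmult n A (\<lambda>i. \<Sum>j\<in>J. x j i) = (\<lambda>i. \<Sum>j\<in>J. mvmult n A (x j) i)"
  by (rule ext) (simp add: mvmult_def sum_distrib_left sum.swap[of _ "{..<n}" J])

lemma mvmult_zero [simp]: "mvmult n A (\<lambda>_. 0) = (\<lambda>_. 0)"
  by (simp add: mvmult_def)

lemma mvmult_mmult: "mvmult n (mmult n A B) x = mvmult n A (mvmult n B x)"
proof (rule ext)
  fix i
  have "mvmult n (mmult n A B) x i = (\<Sum>j<n. \<Sum>k<n. A i k * B k j * x j)"
    by (simp add: mvmult_def mmult_def sum_distrib_right)
  also have "\<dots> = (\<Sum>k<n. \<Sum>j<n. A i k * B k j * x j)"
    by (rule sum.swap)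
  finally show "mvmult n (mmult n A B) x i = mvmult n A (mvmult n B x) i"
    by (simp add: mvmult_def sum_distrib_left mult.assoc)
qed

lemma mmult_assoc: "mmult n (mmult n A B) C = mmult n A (mmult n B C)"
proof (intro ext)
  fix i j
  have "mmult n (mmult n A B) C i j = (\<Sum>k<n. \<Sum>l<n. A i l * B l k * C k j)"
    by (simp add: mmult_def sum_distrib_right)
  also have "\<dots> = (\<Sum>l<n. \<Sum>k<n. A i l * B l k * C k j)"
    by (rule sum.swap)
  finally show "mmult n (mmult n A B) C i j = mmult n A (mmult n B C) i j"
    by (simp add: mmult_def sum_distrib_left mult.assoc)
qed

lemma sum_delta_mult:
  fixes f :: "nat \<Rightarrow> real"
  shows "(\<Sum>j<n. (if i = j \<and> i < n then 1 else 0) * f j) = (if i < n then f i else 0)"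
proof -
  have "(\<Sum>j<n. (if i = j \<and> i < n then 1 else 0) * f j) = (\<Sum>j<n. if i = j then f j else 0)"
    by (rule sum.cong) auto
  then show ?thesis by (simp add: sum.delta')
qed

lemma mvmult_idm: "x \<in> vecs n \<Longrightarrow> mvmult n (idm n) x = x"
  by (rule ext) (auto simp: mvmult_def idm_def vecs_def sum_delta_mult)

lemma mmult_idm_left: "A \<in> mats n \<Longrightarrow> mmult n (idm n) A = A"
  by (intro ext) (auto simp: mmult_def idm_def mats_def sum_delta_mult)

lemma mmult_idm_right: "A \<in> mats n \<Longrightarrow> mmult n A (idm n) = A"
proof (intro ext)
  fix i j assume A: "A \<in> mats n"
  have "mmult n A (idm n) i j = (\<Sum>k<n. if k = j then A i k else 0)"
    unfolding mmult_def idm_def by (rule sum.cong) auto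
  also have "\<dots> = A i j" using A by (simp add: mats_def sum.delta)
  finally show "mmult n A (idm n) i j = A i j" .
qed

lemma mvmult_vecs: "A \<in> mats n \<Longrightarrow> mvmult n A x \<in> vecs n"
  by (simp add: mvmult_def mats_def vecs_def)

lemma orth_entry_le:
  assumes "orth n A" shows "\<bar>A i j\<bar> \<le> 1"
proof (cases "i < n \<and> j < n")
  case True
  have "mmult n (mtrans A) A j j = 1"
    using assms True by (simp add: orth_def idm_def)
  then have "(\<Sum>k<n. (A k j)\<^sup>2) = 1"
    by (simp add: mmult_def mtrans_def power2_eq_square)
  moreover have "(A i j)\<^sup>2 \<le> (\<Sum>k<n. (A k j)\<^sup>2)"
    using True by (intro member_le_sum) auto
  ultimately have "(A i j)\<^sup>2 \<le> 1" by simp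
  then show ?thesis by (simp add: abs_square_le_1)
next
  case False
  then show ?thesis using assms by (auto simp: orth_def mats_def)
qed

lemma mvmult_orth_bound:
  assumes A: "orth n A" and x: "\<And>j. j < n \<Longrightarrow> \<bar>x j\<bar> \<le> M"
  shows "\<bar>mvmult n A x i\<bar> \<le> real n * M"
proof -
  have "\<bar>mvmult n A x i\<bar> \<le> (\<Sum>j<n. \<bar>A i j * x j\<bar>)"
    unfolding mvmult_def by (rule sum_abs)
  also have "\<dots> \<le> (\<Sum>j<n. 1 * M)"
    unfolding abs_mult using orth_entry_le[OF A] x by (intro sum_mono mult_mono) auto
  finally show ?thesis by simp
qed

lemma emult_assoc: "emult n (emult n g h) k = emult n g (emult n h k)"
  by (auto simp: emult_def mmult_assoc mvmult_mmult mvmult_add add.assoc)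

lemma fst_emult: "fst (emult n g h) = mmult n (fst g) (fst h)"
  by (simp add: emult_def)

lemma snd_emult: "snd (emult n g h) = (\<lambda>i. snd g i + mvmult n (fst g) (snd h) i)"
  by (simp add: emult_def)

lemma act_eid: "x \<in> vecs n \<Longrightarrow> act n (eid n) x = x"
  by (simp add: act_def eid_def mvmult_idm)

lemma emult_eid_left: "g \<in> Eucl n \<Longrightarrow> emult n (eid n) g = g"
  by (auto simp: emult_def eid_def Eucl_def orth_def mmult_idm_left mvmult_idm split: prod.splits)

lemma emult_eid_right: "g \<in> Eucl n \<Longrightarrow> emult n g (eid n) = g"
  by (auto simp: emult_def eid_def Eucl_def orth_def mmult_idm_right split: prod.splits)

lemma einv_left: "g \<in> Eucl n \<Longrightarrow> emult n (einv n g) g = eid n"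
  by (auto simp: emult_def eid_def einv_def Eucl_def orth_def split: prod.splits)

text \<open>\<open>orth\<close> asks for A^T A = I. The other identity A A^T = I is read off,
  without a rank argument, from the assumption that the inverse lies in \<open>Eucl n\<close> too,
  which every subgroup grants.\<close>

lemma einv_einv: 
  assumes "g \<in> Eucl n" "einv n g \<in> Eucl n"
  shows "einv n (einv n g) = g"
proof -
  obtain A b where g: "g = (A, b)" by force
  have b: "b \<in> vecs n" using assms g by (simp add: Eucl_def)
  have "mmult n A (mtrans A) = idm n"
    using assms(2) g by (simp add: einv_def Eucl_def orth_def mtrans_def)
  then show ?thesis 
    using b by (simp add: g einv_def mtrans_def mvmult_minus mvmult_mmult[symmetric] mvmult_idm)
qed

context
  fixes n H assumes H: "esubgroup n H"
begin

lemma sg_Eucl: "g \<in> H \<Longrightarrow> g \<in> Eucl n" using H by (auto simp: esubgroup_def)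
lemma sg_orth: "g \<in> H \<Longrightarrow> orth n (fst g)" by (drule sg_Eucl) (auto simp: Eucl_def)
lemma sg_mats: "g \<in> H \<Longrightarrow> fst g \<in> mats n" using sg_orth by (auto simp: orth_def)
lemma sg_id: "eid n \<in> H" using H by (auto simp: esubgroup_def)
lemma sg_mult: "g \<in> H \<Longrightarrow> h \<in> H \<Longrightarrow> emult n g h \<in> H" using H by (auto simp: esubgroup_def)
lemma sg_inv: "g \<in> H \<Longrightarrow> einv n g \<in> H" using H by (auto simp: esubgroup_def)
lemma sg_id_left: "g \<in> H \<Longrightarrow> emult n (eid n) g = g" using sg_Eucl emult_eid_left by blast
lemma sg_id_right: "g \<in> H \<Longrightarrow> emult n g (eid n) = g" using sg_Eucl emult_eid_right by blast
lemma sg_inv_left: "g \<in> H \<Longrightarrow> emult n (einv n g) g = eid n" using sg_Eucl einv_left by blast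
lemma sg_inv_right: "g \<in> H \<Longrightarrow> emult n g (einv n g) = eid n"
  using sg_inv_left[OF sg_inv] einv_einv sg_Eucl sg_inv by metis
lemma sg_cancel_right: "g \<in> H \<Longrightarrow> h \<in> H \<Longrightarrow> emult n (emult n g h) (einv n h) = g"
  by (simp add: emult_assoc sg_inv_right sg_id_right)
lemma sg_cancel_right': "g \<in> H \<Longrightarrow> h \<in> H \<Longrightarrow> emult n (emult n g (einv n h)) h = g"
  by (simp add: emult_assoc sg_inv_left sg_id_right)
lemma sg_cancel_left': "g \<in> H \<Longrightarrow> h \<in> H \<Longrightarrow> emult n g (emult n (einv n g) h) = h"
  by (simp add: emult_assoc[symmetric] sg_inv_right sg_id_left)
lemma sg_rot_inv: 
  assumes "g \<in> H" "x \<in> vecs n" 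
  shows "mvmult n (fst (einv n g)) (mvmult n (fst g) x) = x"
  using sg_inv_left[OF assms(1)] assms(2)
  by (metis fst_emult eid_def fst_conv mvmult_mmult mvmult_idm)
lemma sg_rot_inv': 
  assumes "g \<in> H" "x \<in> vecs n" 
  shows "mvmult n (fst g) (mvmult n (fst (einv n g)) x) = x"
  using sg_inv_right[OF assms(1)] assms(2)
  by (metis fst_emult eid_def fst_conv mvmult_mmult mvmult_idm)

end

section \<open>Periodic functions and sums over the quotient by a normal subgroup\<close>

lemma normal_subgroup: "enormal n H G \<Longrightarrow> esubgroup n H"
  by (simp add: enormal_def)

lemma normal_subset: "enormal n H G \<Longrightarrow> h \<in> H \<Longrightarrow> h \<in> G"
  by (auto simp: enormal_def)

lemma normal_conj: "enormal n H G \<Longrightarrow> g \<in> G \<Longrightarrow> h \<in> H \<Longrightarrow> emult n (emult n g h) (einv n g) \<in> H"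
  by (auto simp: enormal_def)

lemma normal_commute:
  assumes G: "esubgroup n G" and H: "enormal n H G" and g: "g \<in> G" and t: "t \<in> H"
  obtains t' where "t' \<in> H" "emult n t g = emult n g t'"
proof
  let ?t' = "emult n (emult n (einv n g) t) (einv n (einv n g))"
  have i: "einv n (einv n g) = g" using einv_einv sg_Eucl[OF G] sg_inv[OF G] g by blast
  have tG: "t \<in> G" by (rule normal_subset[OF H t])
  show "?t' \<in> H" by (rule normal_conj[OF H sg_inv[OF G g] t])
  show "emult n t g = emult n g ?t'"
    unfolding i by (simp add: emult_assoc sg_cancel_left'[OF G g] sg_mult[OF G tG g])
qed

text \<open>Periodicity and the shift by \<open>q\<close> are both right multiplications; they are
  compatible because normality rewrites t q as q t' with t' in H.\<close>

lemma periodic_mult: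
  assumes G: "esubgroup n G" and H: "enormal n H G"
    and per: "\<And>g t. g \<in> G \<Longrightarrow> t \<in> H \<Longrightarrow> \<phi> (emult n g t) = \<phi> g"
    and g: "g \<in> G" and q: "q \<in> G" and t: "t \<in> H"
  shows "\<phi> (emult n (emult n g t) q) = \<phi> (emult n g q)"
proof -
  obtain t' where t': "t' \<in> H" "emult n t q = emult n q t'"
    using normal_commute[OF G H q t] by blast
  then have "emult n (emult n g t) q = emult n (emult n g q) t'"
    by (simp add: emult_assoc)
  then show ?thesis using per t' sg_mult[OF G g q] by simp
qed

text \<open>Right multiplication by \<open>q\<close> permutes the cosets g H since H is normal, and
  a periodic function depends only on the coset. On the finite set \<open>C\<close> the induced map
  only has to be shown injective.\<close>

lemma sum_reps_shift:
  fixes \<phi> :: "euc \<Rightarrow> real"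
  assumes G: "esubgroup n G" and H: "enormal n H G" and C: "reps n G H C" and fin: "finite C"
    and per: "\<And>g t. g \<in> G \<Longrightarrow> t \<in> H \<Longrightarrow> \<phi> (emult n g t) = \<phi> g"
    and q: "q \<in> G"
  shows "(\<Sum>g\<in>C. \<phi> (emult n g q)) = (\<Sum>g\<in>C. \<phi> g)"
proof -
  note HG = normal_subset[OF H] and Hs = normal_subgroup[OF H]
  have CG: "c \<in> G" if "c \<in> C" for c using C that by (auto simp: reps_def)
  have ex: "\<exists>c. c \<in> C \<and> (\<exists>h\<in>H. g = emult n c h)" if "g \<in> G" for g
    using C that unfolding reps_def by blast
  have uniq: "c = c'" if "c \<in> C" "c' \<in> C" "h \<in> H" "c' = emult n c h" for c c' h
  proof -
    have "c' = emult n c' (eid n)" using sg_id_right[OF G CG[OF that(2)]] by simp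
    then show ?thesis
      using C CG[OF that(2)] that sg_id[OF Hs] unfolding reps_def by blast
  qed
  define \<rho> where "\<rho> g = (SOME c. c \<in> C \<and> (\<exists>h\<in>H. emult n g q = emult n c h))" for g
  have \<rho>: "\<rho> g \<in> C \<and> (\<exists>h\<in>H. emult n g q = emult n (\<rho> g) h)" if "g \<in> C" for g
    unfolding \<rho>_def by (rule someI_ex[OF ex[OF sg_mult[OF G CG[OF that] q]]])
  have inj: "inj_on \<rho> C"
  proof (rule inj_onI)
    fix a b assume ab: "a \<in> C" "b \<in> C" "\<rho> a = \<rho> b"
    obtain h where h: "h \<in> H" "emult n a q = emult n (\<rho> a) h" using \<rho>[OF ab(1)] by blast
    obtain k where k: "k \<in> H" "emult n b q = emult n (\<rho> a) k" using \<rho>[OF ab(2)] ab(3) by auto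
    \<comment> \<open>\<open>r\<close> leads from a q to b q. Moved past q by normality, it gives b
      = a r' with r' in H, so a and b represent the same coset.\<close>
    define r where "r = emult n (einv n h) k"
    have rH: "r \<in> H" unfolding r_def using h k sg_inv[OF Hs] sg_mult[OF Hs] by blast
    have cG: "\<rho> a \<in> G" using \<rho>[OF ab(1)] CG by blast
    have "emult n (emult n a q) r = emult n (\<rho> a) (emult n h r)"
      by (simp add: h(2) emult_assoc)
    also have "emult n h r = k"
      unfolding r_def by (rule sg_cancel_left'[OF Hs h(1) k(1)])
    finally have 1: "emult n b q = emult n (emult n a q) r" using k by simp
    obtain r' where r': "r' \<in> H" "emult n q r = emult n r' q"
    proof
      show "emult n (emult n q r) (einv n q) \<in> H" by (rule normal_conj[OF H q rH])
      show "emult n q r = emult n (emult n (emult n q r) (einv n q)) q"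
        using sg_cancel_right'[OF G sg_mult[OF G q HG[OF rH]] q] by simp
    qed
    have "emult n b q = emult n (emult n a r') q"
      using 1 r' by (simp add: emult_assoc)
    then have "b = emult n a r'"
      using sg_cancel_right[OF G] CG ab q sg_mult[OF G] HG[OF r'(1)] by metis
    then show "a = b" using uniq ab r' by blast
  qed
  have "\<rho> ` C \<subseteq> C" using \<rho> by blast
  then have bij: "\<rho> ` C = C" using fin inj by (simp add: endo_inj_surj)
  have "(\<Sum>g\<in>C. \<phi> (emult n g q)) = (\<Sum>g\<in>C. \<phi> (\<rho> g))"
  proof (rule sum.cong[OF refl])
    fix g assume "g \<in> C"
    then obtain h where "\<rho> g \<in> C" "h \<in> H" "emult n g q = emult n (\<rho> g) h" using \<rho> by blast
    then show "\<phi> (emult n g q) = \<phi> (\<rho> g)" using per CG by simp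
  qed
  also have "\<dots> = (\<Sum>g\<in>\<rho> ` C. \<phi> g)"
    using inj by (simp add: sum.reindex)
  finally show ?thesis by (simp add: bij)
qed

text \<open>Summation by parts in both directions at once. After expansion, three of the four
  products on the right are products on the left translated by \<open>b a\<close>, \<open>a\<close>
  and \<open>b\<close>; the fourth is common to both sides. Commutation makes the arguments
  match.\<close>

lemma sum_difference_swap:
  fixes \<phi> \<psi> :: "euc \<Rightarrow> real"
  assumes G: "esubgroup n G" and H: "enormal n H G" and C: "reps n G H C" and fin: "finite C"
    and per: "\<And>g t. g \<in> G \<Longrightarrow> t \<in> H \<Longrightarrow> \<phi> (emult n g t) = \<phi> g"
      "\<And>g t. g \<in> G \<Longrightarrow> t \<in> H \<Longrightarrow> \<psi> (emult n g t) = \<psi> g"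
    and a: "a \<in> G" and b: "b \<in> G" and ab: "emult n a b = emult n b a"
  shows "(\<Sum>g\<in>C. (\<phi> (emult n g b) - \<phi> g) * (\<psi> (emult n g a) - \<psi> g)) =
    (\<Sum>g\<in>C. (\<phi> (emult n (emult n g b) a) - \<phi> (emult n g b)) *
            (\<psi> (emult n (emult n g a) b) - \<psi> (emult n g a)))"
proof -
  let ?m = "emult n"
  have gab: "?m (?m g a) b = ?m (?m g b) a" for g by (simp add: emult_assoc ab)
  note pm = periodic_mult[OF G H, of \<phi>] periodic_mult[OF G H, of \<psi>]
  have shift: "(\<Sum>g\<in>C. \<chi> (?m g q)) = (\<Sum>g\<in>C. \<chi> g)"
    if "\<And>g t. g \<in> G \<Longrightarrow> t \<in> H \<Longrightarrow> \<chi> (?m g t) = \<chi> g" "q \<in> G" for \<chi> :: "euc \<Rightarrow> real" and q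
    by (rule sum_reps_shift[OF G H C fin that])
  have 1: "(\<Sum>g\<in>C. \<phi> (?m g (?m b a)) * \<psi> (?m g (?m b a))) = (\<Sum>g\<in>C. \<phi> g * \<psi> g)"
    by (rule shift) (simp_all add: per a b sg_mult[OF G])
  have 2: "(\<Sum>g\<in>C. \<phi> (?m (?m g a) b) * \<psi> (?m g a)) = (\<Sum>g\<in>C. \<phi> (?m g b) * \<psi> g)"
    by (rule shift) (simp_all add: per a b pm)
  have 3: "(\<Sum>g\<in>C. \<phi> (?m g b) * \<psi> (?m (?m g b) a)) = (\<Sum>g\<in>C. \<phi> g * \<psi> (?m g a))"
    by (rule shift) (simp_all add: per a b pm)
  have "(\<Sum>g\<in>C. (\<phi> (?m (?m g b) a) - \<phi> (?m g b)) * (\<psi> (?m (?m g a) b) - \<psi> (?m g a))) =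
     (\<Sum>g\<in>C. \<phi> (?m g (?m b a)) * \<psi> (?m g (?m b a))) - (\<Sum>g\<in>C. \<phi> (?m (?m g a) b) * \<psi> (?m g a))
     - (\<Sum>g\<in>C. \<phi> (?m g b) * \<psi> (?m (?m g b) a)) + (\<Sum>g\<in>C. \<phi> (?m g b) * \<psi> (?m g a))"
    by (simp add: ab emult_assoc algebra_simps sum.distrib sum_subtractf)
  also have "\<dots> = (\<Sum>g\<in>C. (\<phi> (?m g b) - \<phi> g) * (\<psi> (?m g a) - \<psi> g))"
    unfolding 1 2 3 by (simp add: algebra_simps sum.distrib sum_subtractf)
  finally show ?thesis by simp
qed

lemma sum_add_squared_le:
  fixes f g :: "'i \<Rightarrow> real"
  shows "(\<Sum>i\<in>I. (f i + g i)\<^sup>2) \<le> 2 * (\<Sum>i\<in>I. (f i)\<^sup>2) + 2 * (\<Sum>i\<in>I. (g i)\<^sup>2)"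
proof -
  have "(f i + g i)\<^sup>2 \<le> 2 * (f i)\<^sup>2 + 2 * (g i)\<^sup>2" for i
    using zero_le_power2[of "f i - g i"] by (simp add: power2_eq_square algebra_simps)
  then have "(\<Sum>i\<in>I. (f i + g i)\<^sup>2) \<le> (\<Sum>i\<in>I. 2 * (f i)\<^sup>2 + 2 * (g i)\<^sup>2)"
    by (rule sum_mono)
  then show ?thesis by (simp add: sum.distrib sum_distrib_left)
qed

section \<open>Linear independence and affine hulls\<close>

text \<open>Gaussian elimination: a vector with nonzero coordinate n serves as pivot and clears this
  coordinate from the others, to which the induction hypothesis applies.\<close>

lemma homogeneous_nontrivial:
  fixes v :: "'j \<Rightarrow> vec"
  assumes "finite J" "n < card J"
  shows "\<exists>c. (\<exists>j\<in>J. c j \<noteq> 0) \<and> (\<forall>i<n. (\<Sum>j\<in>J. c j * v j i) = 0)"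
  using assms
proof (induction n arbitrary: J v)
  case 0
  then obtain j where "j \<in> J" by fastforce
  then show ?case by (intro exI[of _ "\<lambda>_. 1"]) auto
next
  case (Suc n)
  show ?case
  proof (cases "\<forall>j\<in>J. v j n = 0")
    case True
    obtain c where c: "\<exists>j\<in>J. c j \<noteq> 0" "\<forall>i<n. (\<Sum>j\<in>J. c j * v j i) = 0"
      using Suc.IH[of J v] Suc.prems by auto
    then have "\<forall>i<Suc n. (\<Sum>j\<in>J. c j * v j i) = 0"
      using True by (auto simp: less_Suc_eq)
    with c(1) show ?thesis by blast
  next
    case False
    then obtain p where p: "p \<in> J" "v p n \<noteq> 0" by blast
    let ?J = "J - {p}"
    have J: "finite ?J" "n < card ?J" using Suc.prems p(1) by auto
    obtain c where c: "\<exists>j\<in>?J. c j \<noteq> 0"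
        "\<forall>i<n. (\<Sum>j\<in>?J. c j * (v j i - v j n / v p n * v p i)) = 0"
      using Suc.IH[of ?J "\<lambda>j i. v j i - v j n / v p n * v p i"] J by blast
    \<comment> \<open>-r collects the multiples of the pivot that were subtracted from the other
      vectors; it becomes the coefficient of the pivot.\<close>
    define r where "r = (\<Sum>j\<in>?J. c j * (v j n / v p n))"
    define c' where "c' = c(p := - r)"
    have sum: "(\<Sum>j\<in>J. c' j * v j i) = (\<Sum>j\<in>?J. c j * v j i) - r * v p i" for i
      using Suc.prems(1) p(1) by (simp add: sum.remove[of J p] c'_def)
    have "(\<Sum>j\<in>J. c' j * v j i) = 0" if "i < Suc n" for i
    proof (cases "i = n")
      case True
      then show ?thesis using p(2) by (simp add: sum r_def sum_distrib_right)
    next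
      case False
      then have "(\<Sum>j\<in>?J. c j * v j i) - (\<Sum>j\<in>?J. c j * (v j n / v p n) * v p i) = 0"
        using c(2) that by (simp add: right_diff_distrib sum_subtractf mult.assoc)
      then show ?thesis by (simp add: sum r_def sum_distrib_right)
    qed
    moreover have "\<exists>j\<in>J. c' j \<noteq> 0" using c(1) by (auto simp: c'_def)
    ultimately show ?thesis by blast
  qed
qed

lemma lin_indep_le:
  assumes "lin_indep n vs k" shows "k \<le> n"
proof (rule ccontr)
  assume "\<not> k \<le> n"
  then obtain c where "\<exists>j\<in>{..<k}. c j \<noteq> 0" "\<forall>i<n. (\<Sum>j<k. c j * vs j i) = 0"
    using homogeneous_nontrivial[of "{..<k}" n vs] by auto
  then show False using assms unfolding lin_indep_def by blast
qed

text \<open>The given vectors and \<open>y\<close> are n + 1 vectors in R^n, hence dependent;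
  independence of the given ones forces a nonzero coefficient at \<open>y\<close>, by which one
  divides.\<close>

lemma lin_indep_spans:
  assumes "lin_indep n vs n"
  shows "\<exists>c. \<forall>i<n. (\<Sum>j<n. c j * vs j i) = y i"
proof -
  obtain c where c: "\<exists>j\<in>{..<Suc n}. c j \<noteq> 0"
      "\<forall>i<n. (\<Sum>j<Suc n. c j * (if j < n then vs j else y) i) = 0"
    using homogeneous_nontrivial[of "{..<Suc n}" n "\<lambda>j. if j < n then vs j else y"] by auto
  have eq: "(\<Sum>j<n. c j * vs j i) + c n * y i = 0" if "i < n" for i
    using c(2) that by simp
  have cn: "c n \<noteq> 0"
  proof
    assume 0: "c n = 0"
    then have "\<forall>j<n. c j = 0" using eq assms unfolding lin_indep_def by simp
    with 0 c(1) show False by (auto simp: less_Suc_eq)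
  qed
  have "(\<Sum>j<n. - (c j / c n) * vs j i) = y i" if "i < n" for i
  proof -
    have "(\<Sum>j<n. - (c j / c n) * vs j i) = - (\<Sum>j<n. c j * vs j i) / c n"
      by (simp add: sum_negf sum_divide_distrib)
    moreover have "(\<Sum>j<n. c j * vs j i) = - (y i * c n)" using eq[OF that] by (simp add: mult.commute)
    ultimately show ?thesis using cn by simp
  qed
  then show ?thesis by (intro exI[of _ "\<lambda>j. - (c j / c n)"]) simp
qed

lemma affhull_base: "x \<in> X \<Longrightarrow> x \<in> affhull n X"
  unfolding affhull_def
  by (rule CollectI, intro exI[of _ "1::nat"] exI[of _ "\<lambda>_. x"] exI[of _ "\<lambda>_. 1"]) simp

lemma affhull_add_diff:
  assumes a: "a \<in> affhull n X" and x: "x \<in> X" and y: "y \<in> X"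
  shows "(\<lambda>i. a i + r * (x i - y i)) \<in> affhull n X"
proof -
  obtain k :: nat and xs c where k: "\<forall>j<k. xs j \<in> X" "(\<Sum>j<k. c j) = 1" "a = (\<lambda>i. \<Sum>j<k. c j * xs j i)"
    using a unfolding affhull_def by blast
  let ?xs = "\<lambda>j. if j < k then xs j else if j = k then x else y"
  let ?c = "\<lambda>j. if j < k then c j else if j = k then r else - r"
  have "\<forall>j<Suc (Suc k). ?xs j \<in> X" using k(1) x y by auto
  moreover have "(\<Sum>j<Suc (Suc k). ?c j) = 1" using k(2) by simp
  moreover have "(\<lambda>i. a i + r * (x i - y i)) = (\<lambda>i. \<Sum>j<Suc (Suc k). ?c j * ?xs j i)"
    by (rule ext) (simp add: k(3) right_diff_distrib)
  ultimately show ?thesis unfolding affhull_def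
    by (intro CollectI exI[of _ "Suc (Suc k)"] exI[of _ ?xs] exI[of _ ?c] conjI)
qed

lemma affhull_add_diffs:
  assumes "a \<in> affhull n X" "\<And>j. j < (k::nat) \<Longrightarrow> w j \<in> {(\<lambda>i. x i - y i) | x y. x \<in> X \<and> y \<in> X}"
  shows "(\<lambda>i. a i + (\<Sum>j<k. c j * w j i)) \<in> affhull n X"
  using assms(2)
proof (induction k)
  case 0
  then show ?case using assms(1) by simp
next
  case (Suc k)
  obtain x y where xy: "x \<in> X" "y \<in> X" "w k = (\<lambda>i. x i - y i)" using Suc.prems[of k] by blast
  have "(\<lambda>i. a i + (\<Sum>j<k. c j * w j i)) \<in> affhull n X" using Suc by simp
  from affhull_add_diff[OF this xy(1,2), of "c k"] show ?case
    by (simp add: xy(3) add.assoc)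
qed

text \<open>\<open>affdim\<close> is a \<open>Max\<close>, which is informative only on a finite
  nonempty set: independent families have length at most n, and the empty family is one of
  them.\<close>

lemma affdim_props:
  fixes n X
  defines "D \<equiv> {(\<lambda>i. x i - y i) | x y. x \<in> X \<and> y \<in> X}"
  shows "\<exists>vs. (\<forall>j<affdim n X. vs j \<in> D) \<and> lin_indep n vs (affdim n X)"
    and "(\<And>j. j < k \<Longrightarrow> vs j \<in> D) \<Longrightarrow> lin_indep n vs k \<Longrightarrow> k \<le> affdim n X"
proof -
  let ?K = "{k. \<exists>vs. (\<forall>j<k. vs j \<in> D) \<and> lin_indep n vs k}"
  have fin: "finite ?K"
    by (rule finite_subset[of _ "{..n}"]) (auto dest: lin_indep_le)
  have aff: "affdim n X = Max ?K" by (simp add: affdim_def D_def)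
  have "0 \<in> ?K" by (simp add: lin_indep_def)
  then have "Max ?K \<in> ?K" using fin Max_in by blast
  then show "\<exists>vs. (\<forall>j<affdim n X. vs j \<in> D) \<and> lin_indep n vs (affdim n X)"
    unfolding aff by blast
  show "k \<le> affdim n X" if "\<And>j. j < k \<Longrightarrow> vs j \<in> D" "lin_indep n vs k"
    unfolding aff using that by (intro Max_ge[OF fin]) blast
qed

text \<open>Turns Property 1 of \<open>R\<close> into a linear statement. There are
  \<open>daff\<close> independent differences of orbit points; they lie in {0} x R^daff and so form
  a basis of it. Hence x0 + y is in the affine hull of the orbit and is an affine combination of
  points coming from \<open>R\<close>; subtracting x0 leaves displacements.\<close>

lemma orbit_span:
  fixes G R :: "euc set"
  assumes G: "esubgroup d G" and x0: "x0 \<in> vecs d"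
    and R: "affhull d ((\<lambda>g. act d g x0) ` R) = affhull d ((\<lambda>g. act d g x0) ` G)"
    and daff: "daff = affdim d ((\<lambda>g. act d g x0) ` G)"
    and zero: "\<And>g i. g \<in> G \<Longrightarrow> i < d - daff \<Longrightarrow> act d g x0 i = 0"
    and y: "y \<in> vecs d" "\<And>i. i < d - daff \<Longrightarrow> y i = 0"
  shows "\<exists>(m::nat) p c. (\<forall>j<m. p j \<in> R) \<and> y = (\<lambda>i. \<Sum>j<m. c j * (act d (p j) x0 i - x0 i))"
proof -
  let ?X = "(\<lambda>g. act d g x0) ` G"
  let ?D = "{(\<lambda>i. x i - y i) | x y. x \<in> ?X \<and> y \<in> ?X}"
  have actv: "act d g x0 \<in> vecs d" if "g \<in> G" for g
    using mvmult_vecs[OF sg_mats[OF G that], of x0] sg_Eucl[OF G that]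
    by (auto simp: act_def vecs_def Eucl_def)
  obtain vs where vs: "\<And>j. j < daff \<Longrightarrow> vs j \<in> ?D" and indep: "lin_indep d vs daff"
    using affdim_props(1)[of d ?X] unfolding daff by blast
  have le: "daff \<le> d" using lin_indep_le[OF indep] .
  have vs0: "vs j i = 0" if j: "j < daff" and i: "i < d - daff \<or> d \<le> i" for i j
  proof -
    obtain g h where gh: "g \<in> G" "h \<in> G" "vs j = (\<lambda>i. act d g x0 i - act d h x0 i)"
      using vs[OF j] by blast
    then show ?thesis
      using i zero[of g i] zero[of h i] actv[of g] actv[of h] by (auto simp: vecs_def)
  qed
  \<comment> \<open>Dropping the coordinates that vanish makes the system square, as
    \<open>lin_indep_spans\<close> requires.\<close>
  let ?w = "\<lambda>j i. vs j (i + (d - daff))"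
  have "lin_indep daff ?w daff"
    unfolding lin_indep_def
  proof (intro allI impI)
    fix c j assume c: "\<forall>i<daff. (\<Sum>j<daff. c j * ?w j i) = 0" and j: "j < daff"
    have "(\<Sum>j<daff. c j * vs j i) = 0" if "i < d" for i
    proof (cases "i < d - daff")
      case True
      then show ?thesis using vs0 by simp
    next
      case False
      then show ?thesis using c[rule_format, of "i - (d - daff)"] that le by simp
    qed
    then show "c j = 0" using indep j unfolding lin_indep_def by blast
  qed
  then obtain c where c: "\<And>i. i < daff \<Longrightarrow> (\<Sum>j<daff. c j * ?w j i) = y (i + (d - daff))"
    using lin_indep_spans[of daff ?w "\<lambda>i. y (i + (d - daff))"] by blast
  have yc: "(\<Sum>j<daff. c j * vs j i) = y i" for i
  proof -
    consider "i < d - daff" | "d - daff \<le> i" "i < d" | "d \<le> i" by linarith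
    then show ?thesis
    proof cases
      case 2
      then show ?thesis using c[of "i - (d - daff)"] le by simp
    qed (use vs0 y in \<open>auto simp: vecs_def\<close>)
  qed
  have "x0 \<in> ?X" using sg_id[OF G] act_eid[OF x0] by force
  then have "(\<lambda>i. x0 i + (\<Sum>j<daff. c j * vs j i)) \<in> affhull d ?X"
    by (intro affhull_add_diffs affhull_base vs)
  then have "(\<lambda>i. x0 i + y i) \<in> affhull d ((\<lambda>g. act d g x0) ` R)"
    unfolding yc R .
  then obtain m :: nat and xs b where b: "\<And>j. j < m \<Longrightarrow> xs j \<in> (\<lambda>g. act d g x0) ` R" "(\<Sum>j<m. b j) = 1"
      "(\<lambda>i. x0 i + y i) = (\<lambda>i. \<Sum>j<m. b j * xs j i)"
    unfolding affhull_def by blast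
  have "\<forall>j. \<exists>p. j < m \<longrightarrow> p \<in> R \<and> xs j = act d p x0" using b(1) by blast
  then obtain p where p: "\<And>j. j < m \<Longrightarrow> p j \<in> R \<and> xs j = act d (p j) x0" by metis
  have "y i = (\<Sum>j<m. b j * (act d (p j) x0 i - x0 i))" for i
  proof -
    have "(\<Sum>j<m. b j * (act d (p j) x0 i - x0 i)) = (\<Sum>j<m. b j * xs j i) - (\<Sum>j<m. b j) * x0 i"
      using p by (simp add: right_diff_distrib sum_subtractf sum_distrib_right)
    also have "\<dots> = y i" using fun_cong[OF b(3), of i] b(2) by simp
    finally show ?thesis by simp
  qed
  then show ?thesis using p by blast
qed

section \<open>Distances to infinitesimal rigid motions\<close>

lemma skewD: "skew n S \<Longrightarrow> S i j = - S j i"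
  unfolding skew_def by blast

definition sqerr :: "nat \<Rightarrow> euc set \<Rightarrow> (euc \<Rightarrow> vec) \<Rightarrow> (euc \<Rightarrow> vec) \<Rightarrow> real" where
  "sqerr d R w v = (\<Sum>h\<in>R. \<Sum>i<d. (w h i - v h i)\<^sup>2)"

lemma sqerr_nonneg: "0 \<le> sqerr d R w v"
  by (simp add: sqerr_def sum_nonneg)

lemma distR_eq: "distR d R w V = Inf ((\<lambda>v. sqrt (sqerr d R w v)) ` V)"
  unfolding distR_def sqerr_def by (rule arg_cong[where f = Inf]) auto

lemma distR_bdd: "bdd_below ((\<lambda>v. sqrt (sqerr d R w v)) ` V)"
  by (rule bdd_belowI[of _ 0]) (auto simp: sqerr_nonneg)

lemma distR_nonneg: "V \<noteq> {} \<Longrightarrow> 0 \<le> distR d R w V"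
  unfolding distR_eq by (rule cInf_greatest) (auto simp: sqerr_nonneg)

lemma distR_mono: "V \<noteq> {} \<Longrightarrow> V \<subseteq> W \<Longrightarrow> distR d R w W \<le> distR d R w V"
  unfolding distR_eq by (rule cInf_superset_mono) (auto simp: distR_bdd)

lemma distR_sq_le:
  assumes "v \<in> V" shows "(distR d R w V)\<^sup>2 \<le> sqerr d R w v"
proof -
  have "distR d R w V \<le> sqrt (sqerr d R w v)"
    unfolding distR_eq using assms by (intro cInf_lower distR_bdd) auto
  moreover have "0 \<le> distR d R w V" using assms by (intro distR_nonneg) auto
  ultimately have "(distR d R w V)\<^sup>2 \<le> (sqrt (sqerr d R w v))\<^sup>2" by (intro power_mono)
  then show ?thesis by (simp add: sqerr_nonneg)
qed

text \<open>Stands in for a minimiser, whose existence would call for closedness of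
  \<open>V\<close>. The slack is put on the squares because these are summed over
  representatives.\<close>

lemma distR_approx:
  assumes V: "V \<noteq> {}" and "\<delta> > 0"
  shows "\<exists>v\<in>V. sqerr d R w v \<le> (distR d R w V)\<^sup>2 + \<delta>"
proof -
  let ?D = "distR d R w V"
  have "?D < sqrt (?D\<^sup>2 + \<delta>)"
    using real_sqrt_less_mono[of "?D\<^sup>2" "?D\<^sup>2 + \<delta>"] distR_nonneg[OF V, of d R w] assms(2) by simp
  then have "Inf ((\<lambda>v. sqrt (sqerr d R w v)) ` V) < sqrt (?D\<^sup>2 + \<delta>)" by (simp add: distR_eq)
  then have "\<exists>x\<in>(\<lambda>v. sqrt (sqerr d R w v)) ` V. x < sqrt (?D\<^sup>2 + \<delta>)"
    using V by (intro cInf_lessD) auto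
  then obtain v where "v \<in> V" "sqrt (sqerr d R w v) < sqrt (?D\<^sup>2 + \<delta>)" by blast
  then show ?thesis by (intro bexI[of _ v]) auto
qed

lemma zero_mem_Uiso_gen:
  assumes "P (\<lambda>_ _. 0)" shows "(\<lambda>_ _. 0) \<in> Uiso_gen d P x0 R"
  unfolding Uiso_gen_def using assms
  by (auto simp: vecs_def mvmult_def intro!: exI[of _ "\<lambda>_ _. 0"] bexI[of _ "\<lambda>_. 0"])

lemma skew_zero: "skew n (\<lambda>_ _. 0)" and skew0_zero: "skew0 n m (\<lambda>_ _. 0)"
  by (simp_all add: skew_def skew0_def mats_def)

lemma Uiso_nonempty: "Uiso d x0 R \<noteq> {}"
  using zero_mem_Uiso_gen[of "skew d"] by (auto simp: Uiso_def skew_zero)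

lemma Uiso0_nonempty: "Uiso0 d1 d2 x0 R \<noteq> {}"
  using zero_mem_Uiso_gen[of "skew0 d1 d2"] by (auto simp: Uiso0_def skew0_zero)

lemma Uiso0_subset: "Uiso0 d1 d2 x0 R \<subseteq> Uiso (d1 + d2) x0 R"
  unfolding Uiso0_def Uiso_def Uiso_gen_def skew0_def by blast

section \<open>Consistency of neighbouring approximants\<close>

text \<open>\<open>k0\<close> is \<open>d - daff\<close> in the application.\<close>

locale orbit =
  fixes d1 d2 d k0 :: nat and G R R' R'' :: "euc set" and x0 :: vec
  assumes d_def: "d = d1 + d2" and k0: "k0 \<le> d1"
    and G: "esubgroup d G" and x0: "x0 \<in> vecs d"
    and R: "R \<subseteq> G" "R' \<subseteq> G" "R'' \<subseteq> G" "eid d \<in> R'" "eid d \<in> R''"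
    and R_mult: "\<And>h k. h \<in> R' \<Longrightarrow> k \<in> R'' \<Longrightarrow> emult d h k \<in> R"
    and R_gen: "egen d R' = G"
    and block: "\<And>g i. g \<in> G \<Longrightarrow> i < d1 \<Longrightarrow> snd g i = 0"
      "\<And>g i j. g \<in> G \<Longrightarrow> i < d1 \<Longrightarrow> d1 \<le> j \<Longrightarrow> fst g i j = 0"
      "\<And>g i j. g \<in> G \<Longrightarrow> i < d1 \<Longrightarrow> d1 \<le> j \<Longrightarrow> fst g j i = 0"
    and rot_fix: "\<And>g x i. g \<in> G \<Longrightarrow> x \<in> vecs d \<Longrightarrow> i < k0 \<Longrightarrow> mvmult d (fst g) x i = x i"
    and disp_zero: "\<And>g i. g \<in> G \<Longrightarrow> i < k0 \<Longrightarrow> act d g x0 i = x0 i"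
    and span: "\<And>y. y \<in> vecs d \<Longrightarrow> (\<And>i. i < k0 \<Longrightarrow> y i = 0) \<Longrightarrow>
       \<exists>(m::nat) p c. (\<forall>j<m. p j \<in> R'') \<and> y = (\<lambda>i. \<Sum>j<m. c j * (act d (p j) x0 i - x0 i))"
begin

abbreviation em (infixl "\<odot>" 70) where "g \<odot> h \<equiv> emult d g h"

abbreviation mv :: "mat \<Rightarrow> vec \<Rightarrow> vec" where "mv \<equiv> mvmult d"

definition disp :: "euc \<Rightarrow> vec" where "disp p = (\<lambda>i. act d p x0 i - x0 i)"

text \<open>The span of all displacements \<open>disp p\<close>, on which alone the action of
  \<open>S g\<close> is visible in the data; in the application it is {0} x R^daff.\<close>

definition disp_space :: "vec set" where "disp_space = {y \<in> vecs d. \<forall>i<k0. y i = 0}"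

text \<open>The translation part of the rigid motion at g is replaced by \<open>u g\<close>, its
  approximate value at the identity, where the displacement is zero; so only \<open>S g\<close> has
  to be chosen.\<close>

definition admissible :: "euc set \<Rightarrow> euc set \<Rightarrow> (euc \<Rightarrow> vec) \<Rightarrow> (euc \<Rightarrow> mat) \<Rightarrow> (euc \<Rightarrow> real) \<Rightarrow> bool" where
  "admissible H C u S e \<longleftrightarrow> enormal d H G \<and> reps d G H C \<and> finite C \<and>
     (\<forall>g\<in>G. skew d (S g) \<and> u g \<in> vecs d) \<and>
     (\<forall>g\<in>G. \<forall>t\<in>H. u (g \<odot> t) = u g \<and> S (g \<odot> t) = S g \<and> e (g \<odot> t) = e g) \<and>
     (\<forall>g\<in>G. \<forall>r\<in>R. \<forall>i<d. \<bar>mv (fst r) (u (g \<odot> r)) i - u g i - mv (S g) (disp r) i\<bar> \<le> e g)"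

text \<open>Bounds are uniform in the period, in \<open>u\<close>, \<open>S\<close>, \<open>e\<close> and in the shift \<open>q\<close>; the shift
  makes the notion invariant under right translation without asking \<open>F\<close> to be periodic.\<close>

definition l2_bounded :: "((euc \<Rightarrow> vec) \<Rightarrow> (euc \<Rightarrow> mat) \<Rightarrow> euc \<Rightarrow> real) \<Rightarrow> bool" where
  "l2_bounded F \<longleftrightarrow> (\<exists>K\<ge>0. \<forall>H C u S e. admissible H C u S e \<longrightarrow>
     (\<forall>q\<in>G. (\<Sum>g\<in>C. (F u S (g \<odot> q))\<^sup>2) \<le> K * (\<Sum>g\<in>C. (e g)\<^sup>2)))"

lemmas mult_G = sg_mult[OF G] and inv_G = sg_inv[OF G] and id_G = sg_id[OF G]

lemma admissible_reps: "admissible H C u S e \<Longrightarrow> c \<in> C \<Longrightarrow> c \<in> G"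
  by (auto simp: admissible_def reps_def)

lemma admissible_S: "admissible H C u S e \<Longrightarrow> g \<in> G \<Longrightarrow> skew d (S g)"
  by (auto simp: admissible_def)

lemma admissible_u: "admissible H C u S e \<Longrightarrow> g \<in> G \<Longrightarrow> u g \<in> vecs d"
  by (auto simp: admissible_def)

section \<open>Calculus of quantities bounded in l2 by the errors\<close>

lemma l2_boundedE:
  assumes "l2_bounded F"
  obtains K where "K \<ge> 0" "\<And>H C u S e q. admissible H C u S e \<Longrightarrow> q \<in> G \<Longrightarrow>
    (\<Sum>g\<in>C. (F u S (g \<odot> q))\<^sup>2) \<le> K * (\<Sum>g\<in>C. (e g)\<^sup>2)"
  using assms unfolding l2_bounded_def by metis

lemma l2_bounded_cong:
  assumes "l2_bounded F" "\<And>H C u S e g. admissible H C u S e \<Longrightarrow> g \<in> G \<Longrightarrow> F u S g = F' u S g"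
  shows "l2_bounded F'"
proof -
  have "(\<Sum>g\<in>C. (F' u S (g \<odot> q))\<^sup>2) = (\<Sum>g\<in>C. (F u S (g \<odot> q))\<^sup>2)"
    if "admissible H C u S e" "q \<in> G" for H C u S e q
    using that assms(2)[OF that(1)] admissible_reps[OF that(1)] mult_G by (intro sum.cong) auto
  then show ?thesis using assms(1) unfolding l2_bounded_def by metis
qed

text \<open>The entry point for pointwise bounds: the shift is harmless because \<open>e\<close> is
  periodic.\<close>

lemma l2_bounded_base:
  assumes "\<And>H C u S e g. admissible H C u S e \<Longrightarrow> g \<in> G \<Longrightarrow> \<bar>F u S g\<bar> \<le> e g"
  shows "l2_bounded F"
  unfolding l2_bounded_def
proof (intro exI[of _ 1] conjI allI impI ballI)
  fix H C u S e q assume admissible: "admissible H C u S e" and q: "q \<in> G"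
  have "(\<Sum>g\<in>C. (F u S (g \<odot> q))\<^sup>2) \<le> (\<Sum>g\<in>C. (e (g \<odot> q))\<^sup>2)"
    using assms[OF admissible] admissible_reps[OF admissible] mult_G q
    by (intro sum_mono) (metis abs_ge_zero power2_abs power_mono)
  also have "\<dots> = (\<Sum>g\<in>C. (e g)\<^sup>2)"
    using admissible by (intro sum_reps_shift[OF G _ _ _ _ q, of H]) (auto simp: admissible_def)
  finally show "(\<Sum>g\<in>C. (F u S (g \<odot> q))\<^sup>2) \<le> 1 * (\<Sum>g\<in>C. (e g)\<^sup>2)" by simp
qed simp

lemma l2_bounded_add:
  assumes "l2_bounded F" "l2_bounded F'" shows "l2_bounded (\<lambda>u S g. F u S g + F' u S g)"
proof -
  obtain K where K: "K \<ge> 0" "\<And>H C u S e q. admissible H C u S e \<Longrightarrow> q \<in> G \<Longrightarrow>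
    (\<Sum>g\<in>C. (F u S (g \<odot> q))\<^sup>2) \<le> K * (\<Sum>g\<in>C. (e g)\<^sup>2)" using assms(1) by (rule l2_boundedE) blast
  obtain K' where K': "K' \<ge> 0" "\<And>H C u S e q. admissible H C u S e \<Longrightarrow> q \<in> G \<Longrightarrow>
    (\<Sum>g\<in>C. (F' u S (g \<odot> q))\<^sup>2) \<le> K' * (\<Sum>g\<in>C. (e g)\<^sup>2)" using assms(2) by (rule l2_boundedE) blast
  have "(\<Sum>g\<in>C. (F u S (g \<odot> q) + F' u S (g \<odot> q))\<^sup>2) \<le> (2 * K + 2 * K') * (\<Sum>g\<in>C. (e g)\<^sup>2)"
    if "admissible H C u S e" "q \<in> G" for H C u S e q
    using sum_add_squared_le[of "\<lambda>g. F u S (g \<odot> q)" "\<lambda>g. F' u S (g \<odot> q)" C] K(2)[OF that] K'(2)[OF that]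
    by (simp add: algebra_simps)
  then show ?thesis using K(1) K'(1) unfolding l2_bounded_def by (intro exI[of _ "2 * K + 2 * K'"]) simp
qed

lemma l2_bounded_scale:
  assumes "l2_bounded F" shows "l2_bounded (\<lambda>u S g. c * F u S g)"
proof -
  obtain K where K: "K \<ge> 0" "\<And>H C u S e q. admissible H C u S e \<Longrightarrow> q \<in> G \<Longrightarrow>
    (\<Sum>g\<in>C. (F u S (g \<odot> q))\<^sup>2) \<le> K * (\<Sum>g\<in>C. (e g)\<^sup>2)" using assms(1) by (rule l2_boundedE) blast
  have "(\<Sum>g\<in>C. (c * F u S (g \<odot> q))\<^sup>2) \<le> (c\<^sup>2 * K) * (\<Sum>g\<in>C. (e g)\<^sup>2)"
    if "admissible H C u S e" "q \<in> G" for H C u S e q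
    using mult_left_mono[OF K(2)[OF that], of "c\<^sup>2"]
    by (simp add: power_mult_distrib sum_distrib_left mult.assoc)
  then show ?thesis using K(1) unfolding l2_bounded_def by (intro exI[of _ "c\<^sup>2 * K"]) simp
qed

lemma l2_bounded_zero: "l2_bounded (\<lambda>u S g. 0)"
  unfolding l2_bounded_def by (intro exI[of _ 0]) simp

lemma l2_bounded_diff: "l2_bounded F \<Longrightarrow> l2_bounded F' \<Longrightarrow> l2_bounded (\<lambda>u S g. F u S g - F' u S g)"
  using l2_bounded_add[of F "\<lambda>u S g. (-1) * F' u S g"] l2_bounded_scale[of F' "-1"] by simp

lemma l2_bounded_sum:
  assumes "finite I" "\<And>i. i \<in> I \<Longrightarrow> l2_bounded (F i)"
  shows "l2_bounded (\<lambda>u S g. \<Sum>i\<in>I. F i u S g)"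
  using assms by (induction I rule: finite_induct) (auto intro: l2_bounded_zero l2_bounded_add)

lemma l2_bounded_lincomb:
  assumes "finite I" "\<And>i. i \<in> I \<Longrightarrow> l2_bounded (F i)"
  shows "l2_bounded (\<lambda>u S g. \<Sum>i\<in>I. c i * F i u S g)"
  using assms by (intro l2_bounded_sum l2_bounded_scale)

lemma l2_bounded_mv:
  assumes "\<And>j. j < d \<Longrightarrow> l2_bounded (\<lambda>u S g. F u S g j)"
  shows "l2_bounded (\<lambda>u S g. mv A (F u S g) i)"
  unfolding mvmult_def using assms by (intro l2_bounded_lincomb) auto

lemma l2_bounded_shift:
  assumes "l2_bounded F" and p: "p \<in> G" shows "l2_bounded (\<lambda>u S g. F u S (g \<odot> p))"
proof -
  obtain K where K: "K \<ge> 0" "\<And>H C u S e q. admissible H C u S e \<Longrightarrow> q \<in> G \<Longrightarrow>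
    (\<Sum>g\<in>C. (F u S (g \<odot> q))\<^sup>2) \<le> K * (\<Sum>g\<in>C. (e g)\<^sup>2)" using assms(1) by (rule l2_boundedE) blast
  have "(\<Sum>g\<in>C. (F u S (g \<odot> q \<odot> p))\<^sup>2) \<le> K * (\<Sum>g\<in>C. (e g)\<^sup>2)"
    if "admissible H C u S e" "q \<in> G" for H C u S e q
    using K(2)[OF that(1) mult_G[OF that(2) p]] by (simp add: emult_assoc)
  then show ?thesis unfolding l2_bounded_def using K(1) by blast
qed

text \<open>If u comes from one global rigid motion with matrix S0, then S g = rot(g)^-1 S0 rot(g)
  and the difference below vanishes exactly.\<close>

definition rot_consistent :: "euc \<Rightarrow> bool" where
  "rot_consistent p \<longleftrightarrow> (\<forall>y\<in>disp_space. \<forall>i<d.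
     l2_bounded (\<lambda>u S g. mv (fst p) (mv (S (g \<odot> p)) y) i - mv (S g) (mv (fst p) y) i))"

text \<open>The relation that \<open>admissible\<close> postulates on \<open>R\<close>, for
  arbitrary \<open>p\<close>. The pointwise bound becomes an l2 bound, since composition evaluates
  errors at other base points.\<close>

definition disp_consistent :: "euc \<Rightarrow> bool" where
  "disp_consistent p \<longleftrightarrow> (\<forall>i<d. l2_bounded (\<lambda>u S g. mv (fst p) (u (g \<odot> p)) i - u g i - mv (S g) (disp p) i))"

lemma rot_consistentD: "rot_consistent p \<Longrightarrow> y \<in> disp_space \<Longrightarrow> i < d \<Longrightarrow>
    l2_bounded (\<lambda>u S g. mv (fst p) (mv (S (g \<odot> p)) y) i - mv (S g) (mv (fst p) y) i)"
  by (simp add: rot_consistent_def)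

lemma disp_consistentD: "disp_consistent p \<Longrightarrow> i < d \<Longrightarrow> l2_bounded (\<lambda>u S g. mv (fst p) (u (g \<odot> p)) i - u g i - mv (S g) (disp p) i)"
  by (simp add: disp_consistent_def)

lemma disp_in_space:
  assumes p: "p \<in> G" shows "disp p \<in> disp_space"
proof -
  have "snd p \<in> vecs d" using sg_Eucl[OF G p] by (auto simp: Eucl_def)
  then have "disp p \<in> vecs d"
    using mvmult_vecs[OF sg_mats[OF G p], of x0] x0 by (simp add: disp_def act_def vecs_def)
  then show ?thesis using disp_zero[OF p] by (simp add: disp_space_def disp_def)
qed

lemma rot_in_space: "p \<in> G \<Longrightarrow> y \<in> disp_space \<Longrightarrow> mv (fst p) y \<in> disp_space"
  using rot_fix sg_mats[OF G] by (auto simp: disp_space_def mvmult_vecs)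

lemma disp_mult: "disp (p \<odot> q) = (\<lambda>i. disp p i + mv (fst p) (disp q) i)"
  by (rule ext) (simp add: disp_def act_def fst_emult snd_emult mvmult_mmult mvmult_add mvmult_diff)

lemma disp_id: "disp (eid d) = (\<lambda>_. 0)"
  by (simp add: disp_def act_eid x0)

lemma disp_consistent_R: "r \<in> R \<Longrightarrow> disp_consistent r"
  unfolding disp_consistent_def by (intro allI impI l2_bounded_base) (auto simp: admissible_def)

text \<open>The point g h k is reached from the patch at g in one step, and through the patches at g
  and g h in two. On comparison the values of \<open>u\<close> cancel, and \<open>disp_mult\<close>
  leaves exactly the mismatch of the two matrices on \<open>disp k\<close>. By \<open>span\<close>
  this settles all of \<open>disp_space\<close>.\<close>

lemma rot_consistent_R':
  assumes h: "h \<in> R'" shows "rot_consistent h"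
  unfolding rot_consistent_def
proof (intro ballI allI impI)
  fix y i assume y: "y \<in> disp_space" and i: "i < d"
  have hG: "h \<in> G" using h R by blast
  have disp: "l2_bounded (\<lambda>u S g. mv (fst h) (mv (S (g \<odot> h)) (disp k)) i - mv (S g) (mv (fst h) (disp k)) i)"
    if k: "k \<in> R''" for k
  proof -
    have kG: "k \<in> G" using k R by blast
    \<comment> \<open>h and k themselves are in \<open>R\<close> because the identity lies in both
      factors: h = h id and k = id k.\<close>
    have r: "h \<odot> k \<in> R" "h \<in> R" "k \<in> R"
      using R_mult[OF h k] R_mult[OF h R(5)] R_mult[OF R(4) k] sg_id_right[OF G hG] sg_id_left[OF G kG]
      by auto
    note q = r[THEN disp_consistent_R]
    have "l2_bounded (\<lambda>u S g. (mv (fst (h \<odot> k)) (u (g \<odot> (h \<odot> k))) i - u g i - mv (S g) (disp (h \<odot> k)) i)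
      - (mv (fst h) (u (g \<odot> h)) i - u g i - mv (S g) (disp h) i)
      - mv (fst h) (\<lambda>i. mv (fst k) (u (g \<odot> h \<odot> k)) i - u (g \<odot> h) i - mv (S (g \<odot> h)) (disp k) i) i)"
      by (intro l2_bounded_diff l2_bounded_mv disp_consistentD[OF q(1) i] disp_consistentD[OF q(2) i] l2_bounded_shift[OF disp_consistentD[OF q(3)] hG])
    then show ?thesis
      by (rule l2_bounded_cong)
         (simp add: fst_emult mvmult_mmult mvmult_diff disp_mult mvmult_add emult_assoc)
  qed
  obtain m :: nat and p c where p: "\<And>j. j < m \<Longrightarrow> p j \<in> R''" 
      and yc: "y = (\<lambda>i. \<Sum>j<m. c j * disp (p j) i)"
    using span[of y] y unfolding disp_def disp_space_def by blast
  have "l2_bounded (\<lambda>u S g. \<Sum>j<m. c j * (mv (fst h) (mv (S (g \<odot> h)) (disp (p j))) i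
      - mv (S g) (mv (fst h) (disp (p j))) i))"
    using p by (intro l2_bounded_lincomb disp) auto
  then show "l2_bounded (\<lambda>u S g. mv (fst h) (mv (S (g \<odot> h)) y) i - mv (S g) (mv (fst h) y) i)"
    by (rule l2_bounded_cong) (simp add: yc mvmult_sum mvmult_scale sum_subtractf algebra_simps)
qed

text \<open>Go from g to g p and on to g p q. In the second relation \<open>disp q\<close> is met by
  the matrix at g p instead of that at g, and \<open>rot_consistent p\<close> exchanges the two;
  this is why both properties are carried together.\<close>

lemma consistent_mult:
  assumes p: "p \<in> G" "rot_consistent p" "disp_consistent p" and q: "q \<in> G" "rot_consistent q" "disp_consistent q"
  shows "rot_consistent (p \<odot> q)" "disp_consistent (p \<odot> q)"
proof -
  show "rot_consistent (p \<odot> q)" unfolding rot_consistent_def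
  proof (intro ballI allI impI)
    fix y i assume y: "y \<in> disp_space" and i: "i < d"
    have "l2_bounded (\<lambda>u S g. mv (fst p) (\<lambda>i. mv (fst q) (mv (S (g \<odot> p \<odot> q)) y) i 
          - mv (S (g \<odot> p)) (mv (fst q) y) i) i
       + (mv (fst p) (mv (S (g \<odot> p)) (mv (fst q) y)) i - mv (S g) (mv (fst p) (mv (fst q) y)) i))"
      by (intro l2_bounded_add l2_bounded_mv l2_bounded_shift[OF rot_consistentD[OF q(2) y] p(1)] rot_consistentD[OF p(2) rot_in_space[OF q(1) y] i])
    then show "l2_bounded (\<lambda>u S g. mv (fst (p \<odot> q)) (mv (S (g \<odot> (p \<odot> q))) y) i - mv (S g) (mv (fst (p \<odot> q)) y) i)"
      by (rule l2_bounded_cong) (simp add: fst_emult mvmult_mmult mvmult_diff emult_assoc)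
  qed
  show "disp_consistent (p \<odot> q)" unfolding disp_consistent_def
  proof (intro allI impI)
    fix i assume i: "i < d"
    have "l2_bounded (\<lambda>u S g. mv (fst p) (\<lambda>i. mv (fst q) (u (g \<odot> p \<odot> q)) i - u (g \<odot> p) i 
          - mv (S (g \<odot> p)) (disp q) i) i
       + (mv (fst p) (u (g \<odot> p)) i - u g i - mv (S g) (disp p) i)
       + (mv (fst p) (mv (S (g \<odot> p)) (disp q)) i - mv (S g) (mv (fst p) (disp q)) i))"
      by (intro l2_bounded_add l2_bounded_mv l2_bounded_shift[OF disp_consistentD[OF q(3)] p(1)] disp_consistentD[OF p(3) i] rot_consistentD[OF p(2) disp_in_space[OF q(1)] i])
    then show "l2_bounded (\<lambda>u S g. mv (fst (p \<odot> q)) (u (g \<odot> (p \<odot> q))) i - u g i - mv (S g) (disp (p \<odot> q)) i)"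
      by (rule l2_bounded_cong) (simp add: fst_emult mvmult_mmult mvmult_diff mvmult_add disp_mult emult_assoc)
  qed
qed

text \<open>The relation for p at g p^-1, multiplied by -rot(p)^-1, is the one for p^-1; for
  \<open>disp_consistent\<close> the matrix at g p^-1 must again be exchanged for that at g.\<close>

lemma consistent_inv:
  assumes p: "p \<in> G" "rot_consistent p" "disp_consistent p"
  shows "rot_consistent (einv d p)" "disp_consistent (einv d p)"
proof -
  let ?q = "einv d p"
  have q: "?q \<in> G" by (rule inv_G[OF p(1)])
  have cancel: "g \<odot> ?q \<odot> p = g" if "g \<in> G" for g 
    by (rule sg_cancel_right'[OF G that p(1)])
  have sv: "mv (S g) y \<in> vecs d" if "admissible H C u S e" "g \<in> G" for H C u S e g y
    using admissible_S[OF that] by (auto simp: skew_def intro: mvmult_vecs)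
  show "rot_consistent ?q" unfolding rot_consistent_def
  proof (intro ballI allI impI)
    fix y i assume y: "y \<in> disp_space" and i: "i < d"
    let ?y = "mv (fst ?q) y"
    have yv: "mv (fst p) ?y = y" using sg_rot_inv'[OF G p(1)] y by (simp add: disp_space_def)
    have "l2_bounded (\<lambda>u S g. (-1) * mv (fst ?q) (\<lambda>i. mv (fst p) (mv (S (g \<odot> ?q \<odot> p)) ?y) i 
        - mv (S (g \<odot> ?q)) (mv (fst p) ?y) i) i)"
      by (intro l2_bounded_scale l2_bounded_mv l2_bounded_shift[OF rot_consistentD[OF p(2) rot_in_space[OF q y]] q])
    then show "l2_bounded (\<lambda>u S g. mv (fst ?q) (mv (S (g \<odot> ?q)) y) i - mv (S g) (mv (fst ?q) y) i)"
      by (rule l2_bounded_cong) (simp add: cancel yv mvmult_diff sg_rot_inv[OF G p(1) sv])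
  qed
  note rq = this
  have dq: "disp ?q = (\<lambda>i. - mv (fst ?q) (disp p) i)"
  proof 
    fix i
    have "disp (?q \<odot> p) i = 0" by (simp add: sg_inv_left[OF G p(1)] disp_id)
    then show "disp ?q i = - mv (fst ?q) (disp p) i" unfolding disp_mult by linarith
  qed
  show "disp_consistent ?q" unfolding disp_consistent_def
  proof (intro allI impI)
    fix i assume i: "i < d"
    have "l2_bounded (\<lambda>u S g. (-1) * mv (fst ?q) (\<lambda>i. mv (fst p) (u (g \<odot> ?q \<odot> p)) i - u (g \<odot> ?q) i 
          - mv (S (g \<odot> ?q)) (disp p) i) i
       - (mv (fst ?q) (mv (S (g \<odot> ?q)) (disp p)) i - mv (S g) (mv (fst ?q) (disp p)) i))"
      by (intro l2_bounded_diff l2_bounded_scale l2_bounded_mv l2_bounded_shift[OF disp_consistentD[OF p(3)] q] rot_consistentD[OF rq disp_in_space[OF p(1)] i])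
    then show "l2_bounded (\<lambda>u S g. mv (fst ?q) (u (g \<odot> ?q)) i - u g i - mv (S g) (disp ?q) i)"
      by (rule l2_bounded_cong) (simp add: cancel dq mvmult_diff mvmult_minus sg_rot_inv[OF G p(1) admissible_u])
  qed
qed

text \<open>The elements with both properties form a subgroup that contains the generating
  set.\<close>

lemma consistent:
  assumes "p \<in> G" shows "rot_consistent p" "disp_consistent p"
proof -
  let ?H = "{p \<in> G. rot_consistent p \<and> disp_consistent p}"
  have R'R: "h \<in> R" if "h \<in> R'" for h
    using R_mult[OF that R(5)] sg_id_right[OF G, of h] that R(2) by auto
  have "rot_consistent h \<and> disp_consistent h" if "h \<in> R'" for h
    using that rot_consistent_R' disp_consistent_R R'R by blast
  then have "R' \<subseteq> ?H" using R by blast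
  moreover have "esubgroup d ?H" unfolding esubgroup_def
    using G consistent_mult consistent_inv mult_G inv_G rot_consistent_R'[OF R(4)] disp_consistent_R[OF R'R[OF R(4)]] id_G
    by (auto simp: esubgroup_def)
  ultimately have "egen d R' \<subseteq> ?H" unfolding egen_def by blast
  then show "rot_consistent p" "disp_consistent p" using assms R_gen by auto
qed

end

section \<open>Korn inequality for the lower block\<close>

lemma sum_mult_indicator:
  fixes f :: "nat \<Rightarrow> real"
  assumes "finite I"
  shows "(\<Sum>k\<in>I. f k * (if a = k then 1 else 0)) = (if a \<in> I then f a else 0)"
    "(\<Sum>k\<in>I. (if a = k then 1 else 0) * f k) = (if a \<in> I then f a else 0)"
proof -
  have "(\<Sum>k\<in>I. f k * (if a = k then 1 else 0)) = (\<Sum>k\<in>I. if a = k then f k else 0)"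
    by (rule sum.cong) auto
  then show "(\<Sum>k\<in>I. f k * (if a = k then 1 else 0)) = (if a \<in> I then f a else 0)"
    using assms by (simp add: sum.delta')
  then show "(\<Sum>k\<in>I. (if a = k then 1 else 0) * f k) = (if a \<in> I then f a else 0)"
    by (simp add: mult.commute)
qed

text \<open>\<open>s j\<close> is the \<open>m0\<close>-th power of a lift of the \<open>j\<close>-th lattice translation.\<close>

locale lattice_orbit = orbit +
  fixes s :: "nat \<Rightarrow> euc"
  assumes s_G: "\<And>j. j < d2 \<Longrightarrow> s j \<in> G"
    and s_comm: "\<And>i j. i < d2 \<Longrightarrow> j < d2 \<Longrightarrow> emult d (s i) (s j) = emult d (s j) (s i)"
    and s_rot: "\<And>j l m. j < d2 \<Longrightarrow> d1 \<le> l \<Longrightarrow> l < d \<Longrightarrow> d1 \<le> m \<Longrightarrow> m < d \<Longrightarrow>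
      fst (s j) l m = (if l = m then 1 else 0)"
    and s_basis: "\<And>l. d1 \<le> l \<Longrightarrow> l < d \<Longrightarrow> \<exists>c. \<forall>m. d1 \<le> m \<longrightarrow> m < d \<longrightarrow>
      (\<Sum>j<d2. c j * snd (s j) m) = (if m = l then 1 else 0)"
begin

lemma sum_split: "(\<Sum>m<d. F m) = (\<Sum>m<d1. F m) + (\<Sum>m\<in>{d1..<d}. F m)" for F :: "nat \<Rightarrow> real"
  using sum.atLeastLessThan_concat[of 0 d1 d F] by (simp add: d_def lessThan_atLeast0)

lemma mv_upper:
  assumes p: "p \<in> G" and m: "m < d1"
  shows "mv (fst p) x m = (\<Sum>k<d1. fst p m k * x k)"
  unfolding mvmult_def sum_split using block(2)[OF p m] by simp

text \<open>Rotations in G are block diagonal, so the upper left block is orthogonal by itself and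
  preserves the inner product of R^d1.\<close>

lemma orth_upper:
  assumes p: "p \<in> G"
  shows "(\<Sum>m<d1. (\<Sum>n<d1. fst p m n * x n) * (\<Sum>k<d1. fst p m k * z k)) = (\<Sum>n<d1. x n * z n)"
proof -
  have orth: "(\<Sum>m<d1. fst p m n * fst p m k) = (if n = k then 1 else 0)" if "n < d1" for n k
  proof -
    have "mmult d (mtrans (fst p)) (fst p) n k = idm d n k"
      using sg_orth[OF G p] by (simp add: orth_def)
    then have "(\<Sum>m<d. fst p m n * fst p m k) = (if n = k then 1 else 0)"
      using that by (simp add: mmult_def mtrans_def idm_def d_def)
    then show ?thesis
      unfolding sum_split using block(3)[OF p that] by simp
  qed
  have "(\<Sum>m<d1. (\<Sum>n<d1. fst p m n * x n) * (\<Sum>k<d1. fst p m k * z k))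
      = (\<Sum>m<d1. \<Sum>n<d1. \<Sum>k<d1. x n * z k * (fst p m n * fst p m k))"
    by (simp add: sum_product mult_ac)
  also have "\<dots> = (\<Sum>n<d1. \<Sum>m<d1. \<Sum>k<d1. x n * z k * (fst p m n * fst p m k))"
    by (rule sum.swap)
  also have "\<dots> = (\<Sum>n<d1. \<Sum>k<d1. \<Sum>m<d1. x n * z k * (fst p m n * fst p m k))"
    by (intro sum.cong refl sum.swap)
  also have "\<dots> = (\<Sum>n<d1. \<Sum>k<d1. x n * z k * (if n = k then 1 else 0))"
    by (intro sum.cong refl) (simp add: sum_distrib_left[symmetric] orth)
  also have "\<dots> = (\<Sum>n<d1. x n * z n)"
    by (intro sum.cong refl) (simp add: sum_mult_indicator)
  finally show ?thesis .
qed

lemma s_row: "j < d2 \<Longrightarrow> d1 \<le> l \<Longrightarrow> l < d \<Longrightarrow> mv (fst (s j)) x l = x l"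
  unfolding mvmult_def sum_split using block(3)[OF s_G, of j] by (simp add: s_rot sum_mult_indicator)

text \<open>The upper part of \<open>S\<close> rotates the first block of \<open>x0\<close>; adding this correction gives the
  displacement of the point with first block zero, in which only the lower block of \<open>S\<close> is seen.\<close>

definition axis :: "(euc \<Rightarrow> vec) \<Rightarrow> (euc \<Rightarrow> mat) \<Rightarrow> euc \<Rightarrow> nat \<Rightarrow> real" where
  "axis u S g l = u g l + (\<Sum>m<d1. S g m l * x0 m)"

text \<open>Write x0' for the first block of x0 and w for its rotation by p = \<open>s j\<close>, so
  that w - x0' is the first block of \<open>disp p\<close>. The unwanted term of S(g) with w is
  traded, by the conjugation law applied to the l-th unit vector, for a term at g p, where
  orthogonality turns w back into x0'. This completes the difference of \<open>axis\<close>.\<close>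

lemma l2_bounded_axis:
  assumes j: "j < d2" and l: "d1 \<le> l" "l < d"
  shows "l2_bounded (\<lambda>u S g. axis u S (g \<odot> s j) l - axis u S g l - (\<Sum>m\<in>{d1..<d}. S g l m * snd (s j) m))"
proof -
  let ?p = "s j"
  have p: "?p \<in> G" by (rule s_G[OF j])
  define w where "w m = (\<Sum>n<d1. fst ?p m n * x0 n)" for m
  \<comment> \<open>The l-th unit vector: it is in \<open>disp_space\<close> since k0 \<le> d1 \<le>
    l, and the rotation of \<open>s j\<close> fixes it because its lower right block is the
    identity.\<close>
  define E :: vec where "E = (\<lambda>i. if i = l then 1 else 0)"
  have E: "E \<in> disp_space" using l k0 by (auto simp: disp_space_def vecs_def E_def)
  have ME: "mv A E = (\<lambda>k. A k l)" for A
    using l sum_mult_indicator(1)[of "{..<d}" _ l] by (simp add: mvmult_def E_def eq_commute[of l])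
  have rE: "mv (fst ?p) E = E"
  proof
    fix m
    consider "m < d1" | "d1 \<le> m" "m < d" | "d \<le> m" by linarith
    then show "mv (fst ?p) E m = E m"
      using block(2)[OF p _ l(1)] s_rot[OF j _ _ l] sg_mats[OF G p] l
      unfolding ME by cases (auto simp: E_def mats_def)
  qed
  have 1: "l2_bounded (\<lambda>u S g. mv (fst ?p) (\<lambda>k. S (g \<odot> ?p) k l) m - S g m l)" if "m < d1" for m
    proof -
    have "m < d" using that by (simp add: d_def)
    from rot_consistentD[OF consistent(1)[OF p] E this] show ?thesis unfolding rE unfolding ME .
  qed
  have dl: "disp ?p m = snd ?p m" if "d1 \<le> m" "m < d" for m
    using that j by (simp add: disp_def act_def s_row)
  have du: "disp ?p m = w m - x0 m" if "m < d1" for m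
    using that p by (simp add: disp_def act_def w_def mv_upper block)
  have "l2_bounded (\<lambda>u S g. (mv (fst ?p) (u (g \<odot> ?p)) l - u g l - mv (S g) (disp ?p) l) +
     (\<Sum>m<d1. w m * (mv (fst ?p) (\<lambda>k. S (g \<odot> ?p) k l) m - S g m l)))"
    using l by (intro l2_bounded_add disp_consistentD[OF consistent(2)[OF p]] l2_bounded_lincomb 1) auto
  then show ?thesis
  proof (rule l2_bounded_cong)
    fix H C u S e g assume admissible: "admissible H C u S e" and g: "g \<in> G"
    have skew: "S g l m = - S g m l" for m
      by (rule skewD[OF admissible_S[OF admissible g]])
    have "mv (S g) (disp ?p) l = (\<Sum>m<d1. S g l m * disp ?p m) + (\<Sum>m\<in>{d1..<d}. S g l m * disp ?p m)"
      unfolding mvmult_def by (rule sum_split)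
    also have "(\<Sum>m<d1. S g l m * disp ?p m) = (\<Sum>m<d1. S g m l * x0 m) - (\<Sum>m<d1. w m * S g m l)"
      by (simp add: du skew algebra_simps sum_subtractf)
    also have "(\<Sum>m\<in>{d1..<d}. S g l m * disp ?p m) = (\<Sum>m\<in>{d1..<d}. S g l m * snd ?p m)"
      by (intro sum.cong refl) (simp add: dl)
    finally have Sd: "mv (S g) (disp ?p) l = (\<Sum>m<d1. S g m l * x0 m) - (\<Sum>m<d1. w m * S g m l)
       + (\<Sum>m\<in>{d1..<d}. S g l m * snd ?p m)" .
    have "(\<Sum>m<d1. w m * mv (fst ?p) (\<lambda>k. S (g \<odot> ?p) k l) m) = (\<Sum>m<d1. w m * (\<Sum>k<d1. fst ?p m k * S (g \<odot> ?p) k l))"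
      by (intro sum.cong refl) (simp add: mv_upper[OF p])
    also have "\<dots> = (\<Sum>n<d1. x0 n * S (g \<odot> ?p) n l)"
      unfolding w_def by (rule orth_upper[OF p])
    finally show "(mv (fst ?p) (u (g \<odot> ?p)) l - u g l - mv (S g) (disp ?p) l) +
       (\<Sum>m<d1. w m * (mv (fst ?p) (\<lambda>k. S (g \<odot> ?p) k l) m - S g m l))
      = axis u S (g \<odot> ?p) l - axis u S g l - (\<Sum>m\<in>{d1..<d}. S g l m * snd ?p m)"
      by (simp add: s_row[OF j l] Sd axis_def right_diff_distrib sum_subtractf mult.commute)
  qed
qed

section \<open>Integration by parts along the lattice\<close>

definition phi :: "nat \<Rightarrow> (euc \<Rightarrow> vec) \<Rightarrow> (euc \<Rightarrow> mat) \<Rightarrow> euc \<Rightarrow> real" where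
  "phi i u S g = (\<Sum>l\<in>{d1..<d}. snd (s i) l * axis u S g l)"

text \<open>The lower right block of \<open>S g\<close> as a bilinear form, evaluated on the lattice
  basis formed by the translation parts of the \<open>s i\<close>.\<close>

definition kappa :: "nat \<Rightarrow> nat \<Rightarrow> (euc \<Rightarrow> vec) \<Rightarrow> (euc \<Rightarrow> mat) \<Rightarrow> euc \<Rightarrow> real" where
  "kappa i j u S g = (\<Sum>l\<in>{d1..<d}. \<Sum>m\<in>{d1..<d}. snd (s i) l * S g l m * snd (s j) m)"

lemma l2_bounded_phi:
  assumes "j < d2"
  shows "l2_bounded (\<lambda>u S g. phi i u S (g \<odot> s j) - phi i u S g - kappa i j u S g)"
proof -
  have "l2_bounded (\<lambda>u S g. \<Sum>l\<in>{d1..<d}. snd (s i) l *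
      (axis u S (g \<odot> s j) l - axis u S g l - (\<Sum>m\<in>{d1..<d}. S g l m * snd (s j) m)))"
    using assms by (intro l2_bounded_lincomb l2_bounded_axis) auto
  then show ?thesis
    by (rule l2_bounded_cong) (simp add: phi_def kappa_def right_diff_distrib sum_subtractf sum_distrib_left mult.assoc)
qed

lemma kappa_skew:
  assumes "skew d (S g)" shows "kappa i j u S g = - kappa j i u S g"
proof -
  have "kappa i j u S g = (\<Sum>m\<in>{d1..<d}. \<Sum>l\<in>{d1..<d}. snd (s i) l * S g l m * snd (s j) m)"
    unfolding kappa_def by (rule sum.swap)
  also have "\<dots> = - kappa j i u S g"
    unfolding kappa_def sum_negf[symmetric]
  proof (intro sum.cong refl)
    fix m l
    have "S g l m = - S g m l" by (rule skewD[OF assms])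
    then show "snd (s i) l * S g l m * snd (s j) m = - (snd (s j) m * S g m l * snd (s i) l)" by simp
  qed
  finally show ?thesis .
qed

text \<open>With x and y the mixed differences of \<open>phi i\<close> and \<open>phi j\<close>,
  everything rests on x^2 \<le> (x + y)^2 - 2 x y: skewness makes x + y an error, and also the
  diagonal differences, because \<open>kappa i i\<close> is 0.\<close>

lemma l2_bounded_kappa:
  assumes i: "i < d2" and j: "j < d2"
  shows "l2_bounded (kappa i j)"
proof -
  have kk: "kappa i i u S g = 0" if "admissible H C u S e" "g \<in> G" for H C u S e g i
    using admissible_S[OF that] kappa_skew[of S g i i u] by simp
  have ks: "kappa i j u S g + kappa j i u S g = 0" if "admissible H C u S e" "g \<in> G" for H C u S e g
    using admissible_S[OF that] kappa_skew[of S g i j u] by simp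
  have diag: "l2_bounded (\<lambda>u S g. phi i u S (g \<odot> s i) - phi i u S g)" if "i < d2" for i
    by (rule l2_bounded_cong[OF l2_bounded_phi[OF that, of i]]) (simp add: kk)
  have r: "l2_bounded (\<lambda>u S g. (phi i u S (g \<odot> s j) - phi i u S g) + (phi j u S (g \<odot> s i) - phi j u S g))"
    by (rule l2_bounded_cong[OF l2_bounded_add[OF l2_bounded_phi[OF j, of i] l2_bounded_phi[OF i, of j]]])
       (drule (1) ks, linarith)
  \<comment> \<open>The swap produces the diagonal differences at g s_j and g s_i, so their bounds
    are prepared in shifted form.\<close>
  note r1 = l2_bounded_shift[OF diag[OF i] s_G[OF j]] and r2 = l2_bounded_shift[OF diag[OF j] s_G[OF i]]
  obtain K where K: "K \<ge> 0" "\<And>H C u S e q. admissible H C u S e \<Longrightarrow> q \<in> G \<Longrightarrow>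
    (\<Sum>g\<in>C. ((phi i u S (g \<odot> q \<odot> s j) - phi i u S (g \<odot> q)) + (phi j u S (g \<odot> q \<odot> s i) - phi j u S (g \<odot> q)))\<^sup>2)
     \<le> K * (\<Sum>g\<in>C. (e g)\<^sup>2)" by (rule l2_boundedE[OF r]) blast
  obtain K1 where K1: "K1 \<ge> 0" "\<And>H C u S e q. admissible H C u S e \<Longrightarrow> q \<in> G \<Longrightarrow>
    (\<Sum>g\<in>C. (phi i u S (g \<odot> q \<odot> s j \<odot> s i) - phi i u S (g \<odot> q \<odot> s j))\<^sup>2)
     \<le> K1 * (\<Sum>g\<in>C. (e g)\<^sup>2)" by (rule l2_boundedE[OF r1]) blast
  obtain K2 where K2: "K2 \<ge> 0" "\<And>H C u S e q. admissible H C u S e \<Longrightarrow> q \<in> G \<Longrightarrow>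
    (\<Sum>g\<in>C. (phi j u S (g \<odot> q \<odot> s i \<odot> s j) - phi j u S (g \<odot> q \<odot> s i))\<^sup>2)
     \<le> K2 * (\<Sum>g\<in>C. (e g)\<^sup>2)" by (rule l2_boundedE[OF r2]) blast
  have D: "(\<Sum>g\<in>C. (phi i u S (g \<odot> q \<odot> s j) - phi i u S (g \<odot> q))\<^sup>2) \<le> (K + K1 + K2) * (\<Sum>g\<in>C. (e g)\<^sup>2)"
    if admissible: "admissible H C u S e" and q: "q \<in> G" for H C u S e q
  proof -
    have per: "phi i u S (g \<odot> t) = phi i u S g" if "g \<in> G" "t \<in> H" for g t i
      using admissible that by (simp add: admissible_def phi_def axis_def)
    have H: "enormal d H G" "reps d G H C" "finite C" using admissible by (auto simp: admissible_def)
    define x where "x g = phi i u S (g \<odot> s j) - phi i u S g" for g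
    define y where "y g = phi j u S (g \<odot> s i) - phi j u S g" for g
    define a where "a g = phi i u S (g \<odot> s j \<odot> s i) - phi i u S (g \<odot> s j)" for g
    define b where "b g = phi j u S (g \<odot> s i \<odot> s j) - phi j u S (g \<odot> s i)" for g
    have CG: "g \<odot> eid d = g" if "g \<in> C" for g
      using sg_id_right[OF G admissible_reps[OF admissible that]] .
    have px: "x (g \<odot> t) = x g" if "g \<in> G" "t \<in> H" for g t
      unfolding x_def using per periodic_mult[OF G H(1), of "phi i u S", OF per] that s_G[OF j] by simp
    \<comment> \<open>The bound is wanted at every shift q; as \<open>x\<close> is periodic, q can
      be removed.\<close>
    have "(\<Sum>g\<in>C. x (g \<odot> q) ^ 2) = (\<Sum>g\<in>C. (x g)\<^sup>2)"
      by (rule sum_reps_shift[OF G H _ q]) (simp add: px)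
    \<comment> \<open>The right side exceeds the left by the sum of the squares of
      \<open>y g\<close>, which is given away.\<close>
    also have "\<dots> \<le> (\<Sum>g\<in>C. (x g + y g)\<^sup>2 - 2 * (x g * y g))"
      by (intro sum_mono) (simp add: power2_eq_square algebra_simps)
    also have "\<dots> = (\<Sum>g\<in>C. (x g + y g)\<^sup>2) - 2 * (\<Sum>g\<in>C. x g * y g)"
      by (simp add: sum_subtractf sum_distrib_left)
    also have "(\<Sum>g\<in>C. x g * y g) = (\<Sum>g\<in>C. a g * b g)"
      unfolding x_def y_def a_def b_def
      by (rule sum_difference_swap[OF G H per per s_G[OF i] s_G[OF j] s_comm[OF i j]])
    also have "(\<Sum>g\<in>C. (x g + y g)\<^sup>2) - 2 * (\<Sum>g\<in>C. a g * b g)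
        \<le> (\<Sum>g\<in>C. (x g + y g)\<^sup>2) + ((\<Sum>g\<in>C. (a g)\<^sup>2) + (\<Sum>g\<in>C. (b g)\<^sup>2))"
    proof -
      have "- 2 * (a g * b g) \<le> (a g)\<^sup>2 + (b g)\<^sup>2" for g
        using zero_le_power2[of "a g + b g"] by (simp add: power2_eq_square algebra_simps)
      then have "(\<Sum>g\<in>C. - 2 * (a g * b g)) \<le> (\<Sum>g\<in>C. (a g)\<^sup>2 + (b g)\<^sup>2)"
        by (rule sum_mono)
      then show ?thesis by (simp add: sum.distrib sum_negf sum_distrib_left)
    qed
    also have "\<dots> \<le> K * (\<Sum>g\<in>C. (e g)\<^sup>2) + (K1 * (\<Sum>g\<in>C. (e g)\<^sup>2) + K2 * (\<Sum>g\<in>C. (e g)\<^sup>2))"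
      using K(2)[OF admissible id_G] K1(2)[OF admissible id_G] K2(2)[OF admissible id_G]
      unfolding x_def y_def a_def b_def by (intro add_mono) (simp_all add: CG)
    finally show ?thesis by (simp add: x_def algebra_simps)
  qed
  have "l2_bounded (\<lambda>u S g. phi i u S (g \<odot> s j) - phi i u S g)"
    unfolding l2_bounded_def using K(1) K1(1) K2(1) D by (intro exI[of _ "K + K1 + K2"]) auto
  from l2_bounded_diff[OF this l2_bounded_phi[OF j, of i]] show ?thesis
    by (rule l2_bounded_cong) simp
qed

text \<open>\<open>b\<close> and \<open>c\<close> express the unit vectors l and m in the lattice
  basis, so the entry is the combination of the \<open>kappa i j\<close> with the fixed coefficients
  b i c j.\<close>

lemma l2_bounded_lower_block:
  assumes l: "d1 \<le> l" "l < d" and m: "d1 \<le> m" "m < d"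
  shows "l2_bounded (\<lambda>u S g. S g l m)"
proof -
  obtain b where b: "\<And>m. d1 \<le> m \<Longrightarrow> m < d \<Longrightarrow> (\<Sum>j<d2. b j * snd (s j) m) = (if m = l then 1 else 0)"
    using s_basis[OF l] by blast
  obtain c where c: "\<And>l. d1 \<le> l \<Longrightarrow> l < d \<Longrightarrow> (\<Sum>j<d2. c j * snd (s j) l) = (if l = m then 1 else 0)"
    using s_basis[OF m] by blast
  have "l2_bounded (\<lambda>u S g. \<Sum>i<d2. b i * (\<Sum>j<d2. c j * kappa i j u S g))"
    by (intro l2_bounded_lincomb l2_bounded_kappa) auto
  then show ?thesis
  proof (rule l2_bounded_cong)
    fix H C u S e g
    have inner: "(\<Sum>j<d2. c j * kappa i j u S g) = (\<Sum>l'\<in>{d1..<d}. snd (s i) l' * S g l' m)" for i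
    proof -
      have "(\<Sum>j<d2. c j * kappa i j u S g) =
         (\<Sum>j<d2. \<Sum>l'\<in>{d1..<d}. \<Sum>m'\<in>{d1..<d}. snd (s i) l' * S g l' m' * (c j * snd (s j) m'))"
        by (simp add: kappa_def sum_distrib_left mult_ac)
      also have "\<dots> = (\<Sum>l'\<in>{d1..<d}. \<Sum>j<d2. \<Sum>m'\<in>{d1..<d}. snd (s i) l' * S g l' m' * (c j * snd (s j) m'))"
        by (rule sum.swap)
      also have "\<dots> = (\<Sum>l'\<in>{d1..<d}. \<Sum>m'\<in>{d1..<d}. \<Sum>j<d2. snd (s i) l' * S g l' m' * (c j * snd (s j) m'))"
        by (intro sum.cong refl sum.swap)
      also have "\<dots> = (\<Sum>l'\<in>{d1..<d}. \<Sum>m'\<in>{d1..<d}. snd (s i) l' * S g l' m' * (if m = m' then 1 else 0))"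
        by (intro sum.cong refl) (simp add: sum_distrib_left[symmetric] c eq_commute[of m])
      also have "\<dots> = (\<Sum>l'\<in>{d1..<d}. snd (s i) l' * S g l' m)"
        using m by (intro sum.cong refl) (simp add: sum_mult_indicator)
      finally show ?thesis .
    qed
    have "(\<Sum>i<d2. b i * (\<Sum>l'\<in>{d1..<d}. snd (s i) l' * S g l' m)) =
        (\<Sum>i<d2. \<Sum>l'\<in>{d1..<d}. S g l' m * (b i * snd (s i) l'))"
      by (simp add: sum_distrib_left mult_ac)
    also have "\<dots> = (\<Sum>l'\<in>{d1..<d}. \<Sum>i<d2. S g l' m * (b i * snd (s i) l'))"
      by (rule sum.swap)
    also have "\<dots> = (\<Sum>l'\<in>{d1..<d}. S g l' m * (if l = l' then 1 else 0))"
      by (intro sum.cong refl) (simp add: sum_distrib_left[symmetric] b eq_commute[of l])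
    also have "\<dots> = S g l m"
      using l by (simp add: sum_mult_indicator)
    finally show "(\<Sum>i<d2. b i * (\<Sum>j<d2. c j * kappa i j u S g)) = S g l m"
      by (simp add: inner)
  qed
qed

end

section \<open>From the lower block back to the distances\<close>

context lattice_orbit
begin

lemma lower_block_bound:
  "\<exists>K\<ge>0. \<forall>H C u S e. admissible H C u S e \<longrightarrow>
     (\<Sum>g\<in>C. \<Sum>l\<in>{d1..<d}. \<Sum>m\<in>{d1..<d}. (S g l m)\<^sup>2) \<le> K * (\<Sum>g\<in>C. (e g)\<^sup>2)"
proof -
  let ?I = "{d1..<d} \<times> {d1..<d}"
  define bound where "bound i K \<longleftrightarrow> K \<ge> 0 \<and> (\<forall>H C u S e. admissible H C u S e \<longrightarrow>
      (\<Sum>g\<in>C. (S g (fst i) (snd i))\<^sup>2) \<le> K * (\<Sum>g\<in>C. (e g)\<^sup>2))" for i K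
  have "\<forall>i\<in>?I. \<exists>K. bound i K"
  proof
    fix i assume "i \<in> ?I"
    then have "l2_bounded (\<lambda>u S g. S g (fst i) (snd i))" by (intro l2_bounded_lower_block) auto
    then obtain K where K: "K \<ge> 0" "\<And>H C u S e q. admissible H C u S e \<Longrightarrow> q \<in> G \<Longrightarrow>
      (\<Sum>g\<in>C. (S (g \<odot> q) (fst i) (snd i))\<^sup>2) \<le> K * (\<Sum>g\<in>C. (e g)\<^sup>2)" by (rule l2_boundedE) blast
    have "(\<Sum>g\<in>C. (S g (fst i) (snd i))\<^sup>2) \<le> K * (\<Sum>g\<in>C. (e g)\<^sup>2)" if "admissible H C u S e" for H C u S e
      using K(2)[OF that id_G] sg_id_right[OF G admissible_reps[OF that]] by simp
    then show "\<exists>K. bound i K" using K(1) unfolding bound_def by blast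
  qed
  from bchoice[OF this] obtain K where "\<And>i. i \<in> ?I \<Longrightarrow> bound i (K i)" by blast
  then have K: "\<And>i. i \<in> ?I \<Longrightarrow> K i \<ge> 0"
    "\<And>i H C u S e. i \<in> ?I \<Longrightarrow> admissible H C u S e \<Longrightarrow>
      (\<Sum>g\<in>C. (S g (fst i) (snd i))\<^sup>2) \<le> K i * (\<Sum>g\<in>C. (e g)\<^sup>2)"
    by (auto simp: bound_def)
  have "(\<Sum>g\<in>C. \<Sum>l\<in>{d1..<d}. \<Sum>m\<in>{d1..<d}. (S g l m)\<^sup>2) \<le> (\<Sum>i\<in>?I. K i) * (\<Sum>g\<in>C. (e g)\<^sup>2)"
    if admissible: "admissible H C u S e" for H C u S e
  proof -
    have "(\<Sum>g\<in>C. \<Sum>l\<in>{d1..<d}. \<Sum>m\<in>{d1..<d}. (S g l m)\<^sup>2) = (\<Sum>g\<in>C. \<Sum>i\<in>?I. (S g (fst i) (snd i))\<^sup>2)"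
      by (simp add: sum.cartesian_product case_prod_beta)
    also have "\<dots> = (\<Sum>i\<in>?I. \<Sum>g\<in>C. (S g (fst i) (snd i))\<^sup>2)"
      by (rule sum.swap)
    also have "\<dots> \<le> (\<Sum>i\<in>?I. K i * (\<Sum>g\<in>C. (e g)\<^sup>2))"
      by (intro sum_mono K(2)[OF _ admissible])
    finally show ?thesis by (simp add: sum_distrib_right)
  qed
  then show ?thesis using K(1) by (intro exI[of _ "\<Sum>i\<in>?I. K i"]) (auto intro: sum_nonneg)
qed

lemma dist0_le:
  assumes fin: "finite R" and RG: "R \<subseteq> G"
  shows "\<exists>B\<ge>0. \<forall>w v a A. skew d A \<longrightarrow> a \<in> vecs d \<longrightarrow> (\<forall>h\<in>R. v h \<in> vecs d) \<longrightarrow>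
     (\<forall>h\<in>R. mv (fst h) (v h) = (\<lambda>i. a i + mv A (disp h) i)) \<longrightarrow>
     (distR d R w (Uiso0 d1 d2 x0 R))\<^sup>2 \<le>
       2 * sqerr d R w v + B * (\<Sum>l\<in>{d1..<d}. \<Sum>m\<in>{d1..<d}. (A l m)\<^sup>2)"
proof -
  define D where "D h = (\<Sum>m<d. (disp h m)\<^sup>2)" for h
  \<comment> \<open>The 2 comes from splitting a squared sum, and d^2 is the squared factor of
    \<open>mvmult_orth_bound\<close>.\<close>
  define B where "B = 2 * (\<Sum>h\<in>R. \<Sum>i<d. (real d)\<^sup>2 * D h)"
  have D0: "D h \<ge> 0" for h by (simp add: D_def sum_nonneg)
  have main: "(distR d R w (Uiso0 d1 d2 x0 R))\<^sup>2 \<le> 2 * sqerr d R w v + B * (\<Sum>l\<in>{d1..<d}. \<Sum>m\<in>{d1..<d}. (A l m)\<^sup>2)"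
    if A: "skew d A" and a: "a \<in> vecs d" and v: "\<And>h. h \<in> R \<Longrightarrow> v h \<in> vecs d"
      and eq: "\<And>h. h \<in> R \<Longrightarrow> mv (fst h) (v h) = (\<lambda>i. a i + mv A (disp h) i)" for w v a A
  proof -
    define q where "q = (\<Sum>l\<in>{d1..<d}. \<Sum>m\<in>{d1..<d}. (A l m)\<^sup>2)"
    have q0: "q \<ge> 0" by (simp add: q_def sum_nonneg)
    define Q :: mat where "Q = (\<lambda>i j. if d1 \<le> i \<and> d1 \<le> j then A i j else 0)"
    \<comment> \<open>The contribution of \<open>Q\<close> rotated back by h^-1, so that subtracting
      it from \<open>v h\<close> removes \<open>Q\<close> from the equation.\<close>
    define z where "z h = mv (fst (einv d h)) (mv Q (disp h))" for h
    define v0 where "v0 h = (\<lambda>i. v h i - z h i)" for h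
    have Am: "A \<in> mats d" using A by (simp add: skew_def)
    then have Qm: "Q \<in> mats d" by (auto simp: Q_def mats_def)
    have sk: "skew0 d1 d2 (\<lambda>i j. A i j - Q i j)"
      unfolding skew0_def skew_def d_def[symmetric]
    proof (intro conjI allI impI)
      show "(\<lambda>i j. A i j - Q i j) \<in> mats d" using Am Qm by (simp add: mats_def)
      show "A j i - Q j i = - (A i j - Q i j)" for i j
        using skewD[OF A, of i j] by (simp add: Q_def)
    qed (simp add: Q_def)
    have zv: "z h \<in> vecs d" if "h \<in> R" for h
      unfolding z_def using that RG by (intro mvmult_vecs sg_mats[OF G inv_G]) blast
    have "v0 \<in> Uiso0 d1 d2 x0 R"
      unfolding Uiso0_def Uiso_gen_def d_def[symmetric]
    proof (intro CollectI conjI ballI bexI[OF _ a] exI[of _ "\<lambda>i j. A i j - Q i j"])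
      show "skew0 d1 d2 (\<lambda>i j. A i j - Q i j)" by (rule sk)
      fix h assume h: "h \<in> R"
      show "v0 h \<in> vecs d" using v[OF h] zv[OF h] by (simp add: v0_def vecs_def)
      have "mv (fst h) (z h) = mv Q (disp h)"
        unfolding z_def using h RG by (intro sg_rot_inv'[OF G] mvmult_vecs[OF Qm]) auto
      then have "mv (fst h) (v0 h) = (\<lambda>i. a i + (mv A (disp h) i - mv Q (disp h) i))"
        by (simp add: v0_def mvmult_diff eq[OF h] algebra_simps)
      then show "mv (rot h) (v0 h) = (\<lambda>i. a i + mv (\<lambda>i j. A i j - Q i j) (\<lambda>k. act d h x0 k - x0 k) i)"
        by (simp add: rot_def disp_def mvmult_def left_diff_distrib sum_subtractf)
    qed
    then have "(distR d R w (Uiso0 d1 d2 x0 R))\<^sup>2 \<le> sqerr d R w v0" by (rule distR_sq_le)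
    also have "\<dots> = (\<Sum>h\<in>R. \<Sum>i<d. ((w h i - v h i) + z h i)\<^sup>2)"
      by (simp add: sqerr_def v0_def algebra_simps)
    also have "\<dots> \<le> (\<Sum>h\<in>R. 2 * (\<Sum>i<d. (w h i - v h i)\<^sup>2) + 2 * (\<Sum>i<d. (z h i)\<^sup>2))"
      by (intro sum_mono sum_add_squared_le)
    also have "\<dots> = 2 * sqerr d R w v + 2 * (\<Sum>h\<in>R. \<Sum>i<d. (z h i)\<^sup>2)"
      by (simp add: sqerr_def sum.distrib sum_distrib_left)
    also have "(\<Sum>h\<in>R. \<Sum>i<d. (z h i)\<^sup>2) \<le> (\<Sum>h\<in>R. \<Sum>i<d. (real d)\<^sup>2 * (q * D h))"
    proof (intro sum_mono)
      fix h i assume h: "h \<in> R"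
      have "\<bar>mv Q (disp h) j\<bar> \<le> sqrt (q * D h)" if "j < d" for j
      proof (rule real_le_rsqrt[of "\<bar>mv Q (disp h) j\<bar>", simplified])
        have "(mv Q (disp h) j)\<^sup>2 \<le> (\<Sum>m<d. (Q j m)\<^sup>2) * D h"
          unfolding mvmult_def D_def by (rule Cauchy_Schwarz_ineq_sum)
        also have "(\<Sum>m<d. (Q j m)\<^sup>2) \<le> q"
        proof (cases "d1 \<le> j")
          case True
          have "(\<Sum>m<d. (Q j m)\<^sup>2) = (\<Sum>m\<in>{d1..<d}. (A j m)\<^sup>2)"
            unfolding sum_split using True by (simp add: Q_def)
          also have "\<dots> \<le> q" unfolding q_def
            using True that by (intro member_le_sum[of j "{d1..<d}" "\<lambda>l. \<Sum>m\<in>{d1..<d}. (A l m)\<^sup>2"]) (auto intro: sum_nonneg)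
          finally show ?thesis .
        next
          case False
          then show ?thesis using q0 by (simp add: Q_def)
        qed
        finally show "(mv Q (disp h) j)\<^sup>2 \<le> q * D h" using D0 by (simp add: mult_right_mono)
      qed
      then have "\<bar>z h i\<bar> \<le> real d * sqrt (q * D h)"
        unfolding z_def using h RG by (intro mvmult_orth_bound sg_orth[OF G inv_G]) auto
      then have "(z h i)\<^sup>2 \<le> (real d * sqrt (q * D h))\<^sup>2"
        by (metis abs_ge_zero power2_abs power_mono)
      also have "\<dots> = (real d)\<^sup>2 * (q * D h)"
        using q0 D0[of h] by (simp add: power_mult_distrib)
      finally show "(z h i)\<^sup>2 \<le> (real d)\<^sup>2 * (q * D h)" .
    qed
    also have "2 * (\<Sum>h\<in>R. \<Sum>i<d. (real d)\<^sup>2 * (q * D h)) = B * q"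
      by (simp add: B_def sum_distrib_left sum_distrib_right mult_ac)
    finally show ?thesis by (simp add: q_def)
  qed
  have "B \<ge> 0" using D0 by (simp add: B_def sum_nonneg)
  then show ?thesis
    by (intro exI[of _ B] conjI allI impI main) auto
qed

text \<open>Near-optimal approximants at the representatives are extended to G as constants on
  cosets, which makes them \<open>admissible\<close>. \<open>L\<close> is fixed before H, C and u,
  hence uniform in the period.\<close>

lemma sum_dist0_le:
  assumes fin: "finite R" and id: "eid d \<in> R"
  shows "\<exists>L>0. \<forall>H C u. enormal d H G \<longrightarrow> reps d G H C \<longrightarrow> finite C \<longrightarrow>
     (\<forall>g\<in>G. u g \<in> vecs d) \<longrightarrow> periodic d G H u \<longrightarrow>
     (\<Sum>c\<in>C. (distR d R (\<lambda>h. u (c \<odot> h)) (Uiso0 d1 d2 x0 R))\<^sup>2)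
      \<le> L * (\<Sum>c\<in>C. (distR d R (\<lambda>h. u (c \<odot> h)) (Uiso d x0 R))\<^sup>2)"
proof -
  obtain K where K: "K \<ge> 0" "\<And>H C u S e. admissible H C u S e \<Longrightarrow>
     (\<Sum>g\<in>C. \<Sum>l\<in>{d1..<d}. \<Sum>m\<in>{d1..<d}. (S g l m)\<^sup>2) \<le> K * (\<Sum>g\<in>C. (e g)\<^sup>2)"
    using lower_block_bound by blast
  obtain B where B: "B \<ge> 0" "\<And>w v a A. skew d A \<Longrightarrow> a \<in> vecs d \<Longrightarrow> (\<forall>h\<in>R. v h \<in> vecs d) \<Longrightarrow>
     (\<forall>h\<in>R. mv (fst h) (v h) = (\<lambda>i. a i + mv A (disp h) i)) \<Longrightarrow>
     (distR d R w (Uiso0 d1 d2 x0 R))\<^sup>2 \<le>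
       2 * sqerr d R w v + B * (\<Sum>l\<in>{d1..<d}. \<Sum>m\<in>{d1..<d}. (A l m)\<^sup>2)"
    using dist0_le[OF fin R(1)] by blast
  \<comment> \<open>2 and \<open>B\<close> come from \<open>dist0_le\<close>, \<open>K\<close> from
    \<open>lower_block_bound\<close>. The factor d + 1 is that of \<open>e\<close> below: the error
    at r after rotation costs d, the error at the identity costs 1.\<close>
  define L where "L = 2 + B * (K * (real d + 1)\<^sup>2)"
  have L: "L > 0" using K(1) B(1) by (simp add: L_def add_pos_nonneg)
  have "(\<Sum>c\<in>C. (distR d R (\<lambda>h. u (c \<odot> h)) (Uiso0 d1 d2 x0 R))\<^sup>2)
      \<le> L * (\<Sum>c\<in>C. (distR d R (\<lambda>h. u (c \<odot> h)) (Uiso d x0 R))\<^sup>2)"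
    if H: "enormal d H G" and C: "reps d G H C" and finC: "finite C"
      and u: "\<And>g. g \<in> G \<Longrightarrow> u g \<in> vecs d" and per: "periodic d G H u" for H C u
  proof (rule field_le_epsilon)
    fix \<epsilon> :: real assume "\<epsilon> > 0"
    \<comment> \<open>The total slack L |C| \<delta> is then at most \<epsilon>; the + 1 keeps the
      denominator positive.\<close>
    define \<delta> where "\<delta> = \<epsilon> / (L * (real (card C) + 1))"
    have \<delta>: "\<delta> > 0" using \<open>\<epsilon> > 0\<close> L by (simp add: \<delta>_def)
    let ?w = "\<lambda>c h. u (c \<odot> h)"
    define good where "good c v a A \<longleftrightarrow> skew d A \<and> a \<in> vecs d \<and> (\<forall>h\<in>R. v h \<in> vecs d) \<and>
        (\<forall>h\<in>R. mv (fst h) (v h) = (\<lambda>i. a i + mv A (disp h) i)) \<and>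
        sqerr d R (?w c) v \<le> (distR d R (?w c) (Uiso d x0 R))\<^sup>2 + \<delta>" for c v a A
    have "\<forall>c. \<exists>v a A. good c v a A"
    proof
      fix c
      obtain v where v: "v \<in> Uiso d x0 R" "sqerr d R (?w c) v \<le> (distR d R (?w c) (Uiso d x0 R))\<^sup>2 + \<delta>"
        using distR_approx[OF Uiso_nonempty \<delta>] by blast
      then show "\<exists>v a A. good c v a A"
        unfolding good_def Uiso_def Uiso_gen_def disp_def rot_def by blast
    qed
    then obtain v a A where "\<And>c. good c (v c) (a c) (A c)" by metis
    then have A: "\<And>c. skew d (A c)" and a: "\<And>c. a c \<in> vecs d"
        and v: "\<And>c h. h \<in> R \<Longrightarrow> v c h \<in> vecs d"
        and eq: "\<And>c h. h \<in> R \<Longrightarrow> mv (fst h) (v c h) = (\<lambda>i. a c i + mv (A c) (disp h) i)"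
        and err: "\<And>c. sqerr d R (?w c) (v c) \<le> (distR d R (?w c) (Uiso d x0 R))\<^sup>2 + \<delta>"
      by (simp_all add: good_def)
    define rep where "rep g = (THE c. c \<in> C \<and> (\<exists>t\<in>H. g = c \<odot> t))" for g
    have CG: "c \<in> G" if "c \<in> C" for c using C that by (auto simp: reps_def)
    note Hs = normal_subgroup[OF H] and HG = normal_subset[OF H]
    have rep_eq: "rep (c \<odot> t) = c" if "c \<in> C" "t \<in> H" for c t
      unfolding rep_def
      using C CG[OF that(1)] HG[OF that(2)] mult_G that unfolding reps_def
      by (intro the1_equality) blast+
    have rep: "\<exists>t\<in>H. rep g \<in> C \<and> g = rep g \<odot> t" if "g \<in> G" for g
    proof -
      obtain c t where "c \<in> C" "t \<in> H" "g = c \<odot> t" using C \<open>g \<in> G\<close> unfolding reps_def by blast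
      then show ?thesis using rep_eq by auto
    qed
    have rep_C: "rep c = c" if "c \<in> C" for c
      using rep_eq[OF that sg_id[OF Hs]] sg_id_right[OF G CG[OF that]] by simp
    define err' where "err' c = sqrt (sqerr d R (?w c) (v c))" for c
    define S where "S g = A (rep g)" for g
    define e where "e g = (real d + 1) * err' (rep g)" for g
    have comp: "\<bar>u (c \<odot> h) j - v c h j\<bar> \<le> err' c" if "h \<in> R" "j < d" for c h j
    proof -
      have "(u (c \<odot> h) j - v c h j)\<^sup>2 \<le> (\<Sum>i<d. (u (c \<odot> h) i - v c h i)\<^sup>2)"
        using that by (intro member_le_sum[of j "{..<d}" "\<lambda>i. (u (c \<odot> h) i - v c h i)\<^sup>2"]) auto
      also have "\<dots> \<le> sqerr d R (?w c) (v c)"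
        unfolding sqerr_def using that fin
        by (intro member_le_sum[of h R "\<lambda>h. \<Sum>i<d. (u (c \<odot> h) i - v c h i)\<^sup>2"]) (auto intro: sum_nonneg)
      finally show ?thesis unfolding err'_def by (metis real_sqrt_abs real_sqrt_le_mono)
    qed
    have "admissible H C u S e"
      unfolding admissible_def
    proof (intro conjI ballI allI impI)
      show "enormal d H G" "reps d G H C" "finite C" by fact+
      fix g assume g: "g \<in> G"
      show "skew d (S g)" "u g \<in> vecs d" using A u[OF g] by (simp_all add: S_def)
      obtain t where t: "t \<in> H" "rep g \<in> C" "g = rep g \<odot> t" using rep[OF g] by blast
      {
        fix t' assume t': "t' \<in> H"
        show "u (g \<odot> t') = u g" using per g t' by (simp add: periodic_def)
        have "g \<odot> t' = rep g \<odot> (t \<odot> t')" using t(3) by (metis emult_assoc)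
        then have "rep (g \<odot> t') = rep g" using rep_eq[OF t(2) sg_mult[OF Hs t(1) t']] by simp
        then show "S (g \<odot> t') = S g" "e (g \<odot> t') = e g" by (simp_all add: S_def e_def)
      }
      fix r i assume r: "r \<in> R" and i: "i < d"
      let ?c = "rep g"
      have rG: "r \<in> G" using r R by blast
      \<comment> \<open>By normality, the patch of u at g is the patch at its
        representative.\<close>
      have pu: "u (g \<odot> q) = u (?c \<odot> q)" if "q \<in> G" for q
        using periodic_mult[OF G H, of u ?c q t] per CG[OF t(2)] that t by (simp add: periodic_def)
      have ug: "u g = u (?c \<odot> eid d)"
        using pu[OF id_G] sg_id_right[OF G g] by simp
      \<comment> \<open>At the identity the displacement is zero, so the translation part is the
        value of the approximant there.\<close>
      have av: "a ?c i = v ?c (eid d) i" 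
      proof -
        have "mv (idm d) (v ?c (eid d)) = (\<lambda>i. a ?c i)"
          using eq[OF id, of ?c] unfolding disp_id by (simp add: eid_def)
        then show ?thesis by (simp add: mvmult_idm v[OF id])
      qed
      have "mv (fst r) (u (g \<odot> r)) i - u g i - mv (S g) (disp r) i =
         mv (fst r) (\<lambda>j. u (?c \<odot> r) j - v ?c r j) i - (u (?c \<odot> eid d) i - v ?c (eid d) i)"
        by (simp add: mvmult_diff eq[OF r] pu[OF rG] ug S_def av)
      moreover have "\<bar>mv (fst r) (\<lambda>j. u (?c \<odot> r) j - v ?c r j) i\<bar> \<le> real d * err' ?c"
        by (rule mvmult_orth_bound[OF sg_orth[OF G rG]]) (rule comp[OF r])
      ultimately show "\<bar>mv (fst r) (u (g \<odot> r)) i - u g i - mv (S g) (disp r) i\<bar> \<le> e g"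
        using comp[OF id i, of ?c] unfolding e_def by (simp add: algebra_simps)
    qed
    from K(2)[OF this]
    have "(\<Sum>c\<in>C. \<Sum>l\<in>{d1..<d}. \<Sum>m\<in>{d1..<d}. (A c l m)\<^sup>2) \<le> K * (\<Sum>c\<in>C. ((real d + 1) * err' c)\<^sup>2)"
      by (simp add: S_def e_def rep_C)
    also have "(\<Sum>c\<in>C. ((real d + 1) * err' c)\<^sup>2) = (real d + 1)\<^sup>2 * (\<Sum>c\<in>C. sqerr d R (?w c) (v c))"
      by (simp add: power_mult_distrib err'_def sqerr_nonneg sum_distrib_left)
    finally have low: "(\<Sum>c\<in>C. \<Sum>l\<in>{d1..<d}. \<Sum>m\<in>{d1..<d}. (A c l m)\<^sup>2)
       \<le> K * (real d + 1)\<^sup>2 * (\<Sum>c\<in>C. sqerr d R (?w c) (v c))" by (simp add: mult.assoc)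
    have "(\<Sum>c\<in>C. (distR d R (?w c) (Uiso0 d1 d2 x0 R))\<^sup>2)
       \<le> (\<Sum>c\<in>C. 2 * sqerr d R (?w c) (v c) + B * (\<Sum>l\<in>{d1..<d}. \<Sum>m\<in>{d1..<d}. (A c l m)\<^sup>2))"
      using A a v eq by (intro sum_mono B(2)[of _ "a _"]) auto
    also have "\<dots> = 2 * (\<Sum>c\<in>C. sqerr d R (?w c) (v c)) + B * (\<Sum>c\<in>C. \<Sum>l\<in>{d1..<d}. \<Sum>m\<in>{d1..<d}. (A c l m)\<^sup>2)"
      by (simp add: sum.distrib sum_distrib_left)
    also have "\<dots> \<le> L * (\<Sum>c\<in>C. sqerr d R (?w c) (v c))"
      using mult_left_mono[OF low B(1)] by (simp add: L_def algebra_simps)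
    also have "\<dots> \<le> L * (\<Sum>c\<in>C. (distR d R (?w c) (Uiso d x0 R))\<^sup>2 + \<delta>)"
      using L err by (intro mult_left_mono sum_mono) auto
    also have "\<dots> = L * (\<Sum>c\<in>C. (distR d R (?w c) (Uiso d x0 R))\<^sup>2) + L * real (card C) * \<delta>"
      by (simp add: sum.distrib distrib_left)
    also have "L * real (card C) * \<delta> \<le> \<epsilon>"
    proof -
      have "L * (real (card C) + 1) * \<delta> = \<epsilon>"
        using L by (simp add: \<delta>_def)
      then show ?thesis using mult_pos_pos[OF L \<delta>] by (simp add: distrib_left distrib_right)
    qed
    finally show "(\<Sum>c\<in>C. (distR d R (?w c) (Uiso0 d1 d2 x0 R))\<^sup>2)
       \<le> L * (\<Sum>c\<in>C. (distR d R (?w c) (Uiso d x0 R))\<^sup>2) + \<epsilon>" by simp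
  qed
  with L show ?thesis by blast
qed

end

section \<open>Lattice generators\<close>

text \<open>The lower rows of \<open>g\<close> ignore the first d1 coordinates, which makes the
  projection multiplicative.\<close>

lemma proj2_emult:
  assumes "\<And>i j. d1 \<le> i \<Longrightarrow> j < d1 \<Longrightarrow> fst g i j = 0"
  shows "proj2 d1 d2 (emult (d1 + d2) g h) = emult d2 (proj2 d1 d2 g) (proj2 d1 d2 h)"
proof -
  have split: "(\<Sum>k<d1 + d2. F k) = (\<Sum>k<d1. F k) + (\<Sum>k<d2. F (k + d1))" for F :: "nat \<Rightarrow> real"
    using sum.atLeastLessThan_concat[of 0 d1 "d1 + d2" F] sum.shift_bounds_nat_ivl[of F 0 d1 d2]
    by (simp add: lessThan_atLeast0 add.commute)
  have "(\<Sum>k<d1 + d2. fst g (i + d1) k * x k) = (\<Sum>k<d2. fst g (i + d1) (k + d1) * x (k + d1))" for i x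
    unfolding split using assms[of "i + d1"] by simp
  then show ?thesis
    by (auto simp: proj2_def emult_def mmult_def mvmult_def fun_eq_iff cong: if_cong)
qed

lemma proj2_epow:
  assumes G: "esubgroup (d1 + d2) G"
    and block: "\<And>g i j. g \<in> G \<Longrightarrow> d1 \<le> i \<Longrightarrow> j < d1 \<Longrightarrow> fst g i j = 0"
    and t: "t \<in> G" "proj2 d1 d2 t = (idm d2, \<tau>)"
  shows "epow (d1 + d2) t N \<in> G \<and> proj2 d1 d2 (epow (d1 + d2) t N) = (idm d2, \<lambda>i. real N * \<tau> i)"
proof -
  have \<tau>: "\<tau> \<in> vecs d2" using t(2) by (auto simp: proj2_def vecs_def)
  have id: "idm d2 \<in> mats d2" by (simp add: idm_def mats_def)
  show ?thesis
  proof (induction N)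
    case 0
    have "proj2 d1 d2 (eid (d1 + d2)) = (idm d2, \<lambda>i. 0)"
      by (auto simp: proj2_def eid_def idm_def fun_eq_iff)
    then show ?case using sg_id[OF G] by (simp add: epow_def)
  next
    case (Suc N)
    let ?p = "epow (d1 + d2) t N"
    have e: "epow (d1 + d2) t (Suc N) = emult (d1 + d2) t ?p" by (simp add: epow_def)
    have "proj2 d1 d2 (emult (d1 + d2) t ?p) = emult d2 (idm d2, \<tau>) (idm d2, \<lambda>i. real N * \<tau> i)"
      using proj2_emult[of d1 t d2 ?p] block[OF t(1)] t(2) Suc by simp
    also have "\<dots> = (idm d2, \<lambda>i. \<tau> i + real N * \<tau> i)"
      using \<tau> id by (simp add: emult_def mmult_idm_left mvmult_idm vecs_def)
    finally show ?case using sg_mult[OF G t(1)] Suc by (simp add: e algebra_simps)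
  qed
qed

theorem theorem3p21:
  fixes d1 d2 d m0 daff :: nat
    and S G T R :: "euc set"
    and x0 :: vec
  assumes d_def: "d = d1 + d2"
    and S_space: "space_group d2 S"
    and G_sub: "esubgroup d G" and G_disc: "ediscrete d G"
    and G_block: "G \<subseteq> {oplus d1 d2 A s | A s. orth d1 A \<and> s \<in> S}"
    and G_onto: "proj2 d1 d2 ` G = S"
    and T_sub: "T \<subseteq> G" and T_bij: "bij_betw (proj2 d1 d2) T (transl d2 S)"
    and m0: "m0 \<ge> 1"
    and M_char: "\<forall>N\<ge>1. enormal d (Tpow d T N) G \<longleftrightarrow> m0 dvd N"
    and M_fin: "\<forall>N\<ge>1. m0 dvd N \<longrightarrow> finite (lcosets d G (Tpow d T N))"
    and x0: "x0 \<in> vecs d" and x0_inj: "inj_on (\<lambda>g. act d g x0) G"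
    and daff: "daff = affdim d ((\<lambda>g. act d g x0) ` G)"
    and orbit_norm: "\<forall>g\<in>G. \<forall>i<d - daff. act d g x0 i = 0"
    and triv_act: "\<forall>g\<in>G. \<forall>x\<in>vecs d. \<forall>i<d - daff. act d g x i = x i"
    and R: "prop2 d G x0 R"
  shows "\<exists>c C. c > 0 \<and> C > 0 \<and>
     (\<forall>N C\<^sub>N u. N \<ge> 1 \<and> m0 dvd N \<and> reps d G (Tpow d T N) C\<^sub>N \<and>
        (\<forall>g\<in>G. u g \<in> vecs d) \<and> periodic d G (Tpow d T N) u \<longrightarrow>
        c * seminorm d R (Uiso0 d1 d2 x0 R) C\<^sub>N u \<le> seminorm d R (Uiso d x0 R) C\<^sub>N u \<and>
        seminorm d R (Uiso d x0 R) C\<^sub>N u \<le> C * seminorm d R (Uiso0 d1 d2 x0 R) C\<^sub>N u)"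
proof -
  obtain R' R'' where R': "R' \<subseteq> G" "eid d \<in> R'" "egen d R' = G" and R'': "prop1 d G x0 R''"
    and RR: "{emult d g h | g h. g \<in> R' \<and> h \<in> R''} \<subseteq> R" and RG: "R \<subseteq> G" and finR: "finite R"
    using R unfolding prop2_def by blast
  have R''G: "R'' \<subseteq> G" "eid d \<in> R''"
    and aff: "affhull d ((\<lambda>g. act d g x0) ` R'') = affhull d ((\<lambda>g. act d g x0) ` G)"
    using R'' by (auto simp: prop1_def)
  have RM: "emult d h k \<in> R" if "h \<in> R'" "k \<in> R''" for h k using RR that by blast
  have idR: "eid d \<in> R"
    using RM[OF R'(2) R''G(2)] sg_id_left[OF G_sub sg_id[OF G_sub]] by simp
  have block: "i < d1 \<Longrightarrow> snd g i = 0" "i < d1 \<Longrightarrow> d1 \<le> j \<Longrightarrow> fst g i j = 0"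
      "i < d1 \<Longrightarrow> d1 \<le> j \<Longrightarrow> fst g j i = 0" if g: "g \<in> G" for g i j
  proof -
    obtain A s where gs: "g = oplus d1 d2 A s" using G_block g by blast
    show "i < d1 \<Longrightarrow> snd g i = 0" "i < d1 \<Longrightarrow> d1 \<le> j \<Longrightarrow> fst g i j = 0"
      "i < d1 \<Longrightarrow> d1 \<le> j \<Longrightarrow> fst g j i = 0" by (auto simp: gs oplus_def)
  qed
  obtain vs where vs: "\<And>k. k < d2 \<Longrightarrow> (idm d2, vs k) \<in> S" and indep: "lin_indep d2 vs d2"
    using S_space unfolding space_group_def by blast
  have "\<forall>k. \<exists>t. k < d2 \<longrightarrow> t \<in> T \<and> proj2 d1 d2 t = (idm d2, vs k)"
  proof (intro allI)
    fix k
    have "(idm d2, vs k) \<in> proj2 d1 d2 ` T" if "k < d2"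
      using T_bij vs[OF that] unfolding bij_betw_def transl_def by auto
    then show "\<exists>t. k < d2 \<longrightarrow> t \<in> T \<and> proj2 d1 d2 t = (idm d2, vs k)" by (metis imageE)
  qed
  then obtain t where t: "\<And>k. k < d2 \<Longrightarrow> t k \<in> T" "\<And>k. k < d2 \<Longrightarrow> proj2 d1 d2 (t k) = (idm d2, vs k)"
    by metis
  define s where "s k = epow d (t k) m0" for k
  have lower: "fst g i j = 0" if "g \<in> G" "d1 \<le> i" "j < d1" for g i j
    using block(3)[OF that(1,3,2)] .
  note pp = proj2_epow[of d1 d2 G, folded d_def, OF G_sub lower]
  have s: "s k \<in> G" "proj2 d1 d2 (s k) = (idm d2, \<lambda>i. real m0 * vs k i)" if "k < d2" for k
    using pp[of "t k" "vs k" m0] t[OF that] T_sub unfolding s_def by auto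
  \<comment> \<open>The displacements of the \<open>t k\<close> have the independent vectors
    \<open>vs k\<close> as their last d2 coordinates. This yields d - daff \<le> d1, the locale
    assumption on \<open>k0\<close>.\<close>
  have d2_le: "d2 \<le> daff"
    unfolding daff
  proof (rule affdim_props(2))
    let ?w = "\<lambda>k i. act d (t k) x0 i - x0 i"
    have tk: "vs k i = snd (t k) (i + d1)" "fst (t k) (i + d1) j = (if j = i + d1 then 1 else 0)"
      if "k < d2" "i < d2" "j < d" for k i j
    proof -
      have "t k \<in> G" using t(1)[OF that(1)] T_sub by blast
      have "vs k i = snd (proj2 d1 d2 (t k)) i" "fst (proj2 d1 d2 (t k)) i (j - d1) = idm d2 i (j - d1)"
        using t(2)[OF that(1)] by simp_all
      then show "vs k i = snd (t k) (i + d1)" "fst (t k) (i + d1) j = (if j = i + d1 then 1 else 0)"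
        using that block(3)[OF \<open>t k \<in> G\<close>, of j "i + d1"]
        by (cases "j < d1"; auto simp: proj2_def idm_def d_def not_less split: if_splits)+
    qed
    have w: "?w k (i + d1) = vs k i" if "k < d2" "i < d2" for k i
    proof -
      have "mvmult d (fst (t k)) x0 (i + d1) = (\<Sum>j<d. if j = i + d1 then x0 j else 0)"
        unfolding mvmult_def using tk(2)[OF that] by (intro sum.cong) auto
      also have "\<dots> = x0 (i + d1)" using that by (simp add: sum.delta d_def)
      finally show ?thesis using tk(1)[OF that, of 0] that by (simp add: act_def d_def)
    qed
    show "lin_indep d ?w d2"
      unfolding lin_indep_def
    proof (intro allI impI)
      fix c j assume c: "\<forall>i<d. (\<Sum>j<d2. c j * ?w j i) = 0" and j: "j < d2"
      have "(\<Sum>j<d2. c j * vs j i) = 0" if "i < d2" for i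
        using c[rule_format, of "i + d1"] w that by (simp add: d_def)
      then show "c j = 0" using indep j unfolding lin_indep_def by blast
    qed
    show "?w j \<in> {(\<lambda>i. x i - y i) | x y. x \<in> (\<lambda>g. act d g x0) ` G \<and> y \<in> (\<lambda>g. act d g x0) ` G}"
      if "j < d2" for j
      using t(1)[OF that] T_sub act_eid[OF x0] sg_id[OF G_sub] by force
  qed
  interpret lattice_orbit d1 d2 d "d - daff" G R R' R'' x0 s
  proof
    show "d = d1 + d2" "esubgroup d G" "x0 \<in> vecs d" "R \<subseteq> G" "R' \<subseteq> G" "R'' \<subseteq> G" "eid d \<in> R'"
      "eid d \<in> R''" "egen d R' = G" by fact+
    show "d - daff \<le> d1" using d2_le d_def by simp
    show "emult d h k \<in> R" if "h \<in> R'" "k \<in> R''" for h k using RM that .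
    show "snd g i = 0" if "g \<in> G" "i < d1" for g i using block that by blast
    show "fst g i j = 0" if "g \<in> G" "i < d1" "d1 \<le> j" for g i j using block that by blast
    show "fst g j i = 0" if "g \<in> G" "i < d1" "d1 \<le> j" for g i j using block that by blast
    show "mvmult d (fst g) x i = x i" if "g \<in> G" "x \<in> vecs d" "i < d - daff" for g x i
    proof -
      \<comment> \<open>The action on 0 shows that the translation part vanishes in these
        coordinates, so the rotation alone fixes them.\<close>
      have "(\<lambda>_. 0) \<in> vecs d" by (simp add: vecs_def)
      then have "act d g (\<lambda>_. 0) i = 0" using triv_act that by blast
      moreover have "act d g x i = x i" using triv_act that by blast
      ultimately show ?thesis by (simp add: act_def)
    qed
    show "act d g x0 i = x0 i" if "g \<in> G" "i < d - daff" for g i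
      using triv_act x0 that by blast
    show "\<exists>(m::nat) p c. (\<forall>j<m. p j \<in> R'') \<and> y = (\<lambda>i. \<Sum>j<m. c j * (act d (p j) x0 i - x0 i))"
      if y: "y \<in> vecs d" "\<And>i. i < d - daff \<Longrightarrow> y i = 0" for y
      by (rule orbit_span[OF G_sub x0 aff daff _ y]) (use orbit_norm in blast)+
    show "s j \<in> G" if "j < d2" for j using s that by blast
    \<comment> \<open>Both products are m0-th powers, of a and b in T. Their translation parts
      agree; dividing by m0 and using injectivity of the projection on T gives a = b.\<close>
    show "emult d (s i) (s j) = emult d (s j) (s i)" if ij: "i < d2" "j < d2" for i j
    proof -
      have "enormal d (Tpow d T m0) G" using M_char[rule_format, OF m0] by simp
      note Ts = normal_subgroup[OF this]
      have sT: "s i \<in> Tpow d T m0" if "i < d2" for i using t(1)[OF that] unfolding s_def Tpow_def by blast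
      obtain a b where a: "a \<in> T" "emult d (s i) (s j) = epow d a m0"
        and b: "b \<in> T" "emult d (s j) (s i) = epow d b m0"
        using sg_mult[OF Ts sT[OF ij(1)] sT[OF ij(2)]] sg_mult[OF Ts sT[OF ij(2)] sT[OF ij(1)]]
        by (auto simp: Tpow_def)
      have trans: "\<exists>\<tau>. proj2 d1 d2 x = (idm d2, \<tau>)" if "x \<in> T" for x
      proof -
        have "proj2 d1 d2 x \<in> transl d2 S" using T_bij that by (auto simp: bij_betw_def)
        then show ?thesis by (metis (mono_tags, lifting) mem_Collect_eq prod.collapse transl_def)
      qed
      obtain \<alpha> where \<alpha>: "proj2 d1 d2 a = (idm d2, \<alpha>)" using trans[OF a(1)] by blast
      obtain \<beta> where \<beta>: "proj2 d1 d2 b = (idm d2, \<beta>)" using trans[OF b(1)] by blast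
      have comm: "proj2 d1 d2 (emult d (s i) (s j)) = (idm d2, \<lambda>k. real m0 * vs i k + real m0 * vs j k)"
        if "i < d2" "j < d2" for i j
      proof -
        have "(\<lambda>k. real m0 * vs j k) \<in> vecs d2"
        proof -
          have "snd (proj2 d1 d2 (s j)) \<in> vecs d2" by (simp add: proj2_def vecs_def)
          then show ?thesis by (simp add: s(2)[OF that(2)])
        qed
        moreover have "idm d2 \<in> mats d2" by (simp add: idm_def mats_def)
        ultimately show ?thesis
          using proj2_emult[of d1 "s i" d2 "s j", folded d_def, OF lower[OF s(1)[OF that(1)]]]
          by (simp add: s(2) that) (simp add: emult_def mmult_idm_left mvmult_idm)
      qed
      have "(idm d2, \<lambda>k. real m0 * \<alpha> k) = (idm d2, \<lambda>k. real m0 * \<beta> k)"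
        using comm[OF ij] comm[OF ij(2) ij(1)] pp[of a \<alpha> m0] pp[of b \<beta> m0] \<alpha> \<beta> a b
        subsetD[OF T_sub a(1)] subsetD[OF T_sub b(1)] by (simp add: add.commute)
      then have "\<alpha> = \<beta>" using m0 by (simp add: fun_eq_iff)
      then have "a = b" using T_bij a(1) b(1) \<alpha> \<beta> by (auto simp: bij_betw_def inj_on_def)
      then show ?thesis using a b by simp
    qed
    show "fst (s j) l m = (if l = m then 1 else 0)"
      if "j < d2" "d1 \<le> l" "l < d" "d1 \<le> m" "m < d" for j l m
    proof -
      have "fst (proj2 d1 d2 (s j)) (l - d1) (m - d1) = idm d2 (l - d1) (m - d1)"
        using s(2)[OF that(1)] by simp
      moreover have "l - d1 < d2" "m - d1 < d2" "l - d1 = m - d1 \<longleftrightarrow> l = m"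
        using that d_def by auto
      ultimately show ?thesis using that by (simp add: proj2_def idm_def)
    qed
    show "\<exists>c. \<forall>m. d1 \<le> m \<longrightarrow> m < d \<longrightarrow> (\<Sum>j<d2. c j * snd (s j) m) = (if m = l then 1 else 0)" for l
    proof -
      \<comment> \<open>The division by m0 compensates that \<open>s j\<close> translates by m0
        times \<open>vs j\<close>.\<close>
      obtain c where c: "\<And>i. i < d2 \<Longrightarrow> (\<Sum>j<d2. c j * vs j i) = (if i + d1 = l then 1 else 0) / real m0"
        using lin_indep_spans[OF indep, of "\<lambda>i. (if i + d1 = l then 1 else 0) / real m0"] by blast
      have "(\<Sum>j<d2. c j * snd (s j) m) = (if m = l then 1 else 0)" if m: "d1 \<le> m" "m < d" for m
      proof -
        have "snd (s j) m = real m0 * vs j (m - d1)" if "j < d2" for j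
          using arg_cong[OF s(2)[OF that], of "\<lambda>g. snd g (m - d1)"] m by (simp add: proj2_def d_def split: if_splits)
        then have "(\<Sum>j<d2. c j * snd (s j) m) = real m0 * (\<Sum>j<d2. c j * vs j (m - d1))"
          by (simp add: sum_distrib_left mult_ac)
        then show ?thesis using c[of "m - d1"] m m0 by (simp add: d_def)
      qed
      then show ?thesis by blast
    qed
  qed
  obtain L where L: "L > 0" and bound: "\<And>H C u. enormal d H G \<Longrightarrow> reps d G H C \<Longrightarrow> finite C \<Longrightarrow>
     (\<forall>g\<in>G. u g \<in> vecs d) \<Longrightarrow> periodic d G H u \<Longrightarrow>
     (\<Sum>c\<in>C. (distR d R (\<lambda>h. u (emult d c h)) (Uiso0 d1 d2 x0 R))\<^sup>2)
      \<le> L * (\<Sum>c\<in>C. (distR d R (\<lambda>h. u (emult d c h)) (Uiso d x0 R))\<^sup>2)"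
    using sum_dist0_le[OF finR idR] by blast
  show ?thesis
  \<comment> \<open>The second constant is 1 since \<open>Uiso0\<close> is contained in
    \<open>Uiso\<close>; the first has a square root because \<open>L\<close> compares sums of
    squares.\<close>
  proof (rule exI[of _ "1 / sqrt L"], rule exI[of _ 1], intro conjI allI impI)
    show "1 / sqrt L > 0" using L by simp
    fix N C u
    assume N: "N \<ge> 1 \<and> m0 dvd N \<and> reps d G (Tpow d T N) C \<and>
        (\<forall>g\<in>G. u g \<in> vecs d) \<and> periodic d G (Tpow d T N) u"
    show "1 / sqrt L * seminorm d R (Uiso0 d1 d2 x0 R) C u \<le> seminorm d R (Uiso d x0 R) C u"
    \<comment> \<open>A sum over an infinite set is 0 by convention, so both seminorms vanish in
      that case.\<close>
    proof (cases "finite C")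
      case True
      let ?A = "\<Sum>c\<in>C. (distR d R (\<lambda>h. u (emult d c h)) (Uiso0 d1 d2 x0 R))\<^sup>2"
      let ?B = "\<Sum>c\<in>C. (distR d R (\<lambda>h. u (emult d c h)) (Uiso d x0 R))\<^sup>2"
      have "?A \<le> L * ?B" using N M_char True by (intro bound[of "Tpow d T N"]) auto
      then have "1 / real (card C) * ?A \<le> L * (1 / real (card C) * ?B)"
        using mult_left_mono[of ?A "L * ?B" "1 / real (card C)"] by (simp add: mult_ac)
      then have "sqrt (1 / real (card C) * ?A) \<le> sqrt L * sqrt (1 / real (card C) * ?B)"
        unfolding real_sqrt_mult[symmetric] by (rule real_sqrt_le_mono)
      then show ?thesis using L unfolding seminorm_def by (simp add: divide_le_eq mult.commute)
    qed (simp add: seminorm_def)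
    have "distR d R w (Uiso d x0 R) \<le> distR d R w (Uiso0 d1 d2 x0 R)" for w
      using distR_mono[OF Uiso0_nonempty Uiso0_subset] by (simp add: d_def)
    then show "seminorm d R (Uiso d x0 R) C u \<le> 1 * seminorm d R (Uiso0 d1 d2 x0 R) C u"
      unfolding seminorm_def mult_1_left
      by (intro real_sqrt_le_mono mult_left_mono sum_mono power_mono distR_nonneg Uiso_nonempty) auto
  qed simp
qed

end
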